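(* Let $\boldsymbol{x}=(x_1,\dots,x_M)\in\mathbb{R}^M$ with $x_1<\cdots<x_M$, and $\boldsymbol{y}\in\mathbb{R}^M$ with $M\ge2$. Let $E:\mathbb{R}\times\mathbb{R}\to\mathbb{R}^+$ be such that $E(\cdot,y)$ is strictly convex, coercive, and differentiable for every $y\in\mathbb{R}$, and let $\lambda>0$. Then there exists a unique $\boldsymbol{y}_\lambda\in\mathbb{R}^M$ such that, for any $f_{\mathrm{opt}}\in\mathcal{V}_\lambda$, $f_{\mathrm{opt}}(x_m)=y_{\lambda,m}$ for all $m\in\{1,\dots,M\}$. Moreover, $$\mathcal{V}_\lambda=\operatorname*{arg\,min}_{\substack{f\in\mathrm{BV}^{(2)}(\mathbb{R})\\ f(x_m)=y_{\lambda,m},\ m=1,\dots,M}}\|\mathrm{D}^2f\|_{\mathcal{M}}.$$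
   Context: $\mathcal{M}(\mathbb{R})$ is the space of bounded (finite, signed) Radon measures on $\mathbb{R}$ with total-variation norm $\|\cdot\|_{\mathcal{M}}$. $\mathrm{BV}^{(2)}(\mathbb{R})=\{f\in\mathcal{S}'(\mathbb{R}):\mathrm{D}^2f\in\mathcal{M}(\mathbb{R})\}$, where $\mathrm{D}^2$ is the distributional second derivative; its elements are continuous functions. $\mathcal{V}_\lambda$ is the set of minimizers over $f\in\mathrm{BV}^{(2)}(\mathbb{R})$ of $\sum_{m=1}^ME(f(x_m),y_m)+\lambda\|\mathrm{D}^2f\|_{\mathcal{M}}$ (this is the problem (gBLASSO)). It is known that $\mathcal{V}_\lambda$ is nonempty. *)

theory Defs
  imports "HOL-Analysis.Analysis"
begin

section \<open>Tempered distributions on the real line\<close>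

definition schwartz :: "(real \<Rightarrow> real) set" where
  "schwartz = {\<phi>. (\<forall>n x. (deriv ^^ n) \<phi> differentiable at x) \<and>
                  (\<forall>k n. bounded (range (\<lambda>x. x ^ k * (deriv ^^ n) \<phi> x)))}"

definition schwartz_seminorm :: "nat \<Rightarrow> nat \<Rightarrow> (real \<Rightarrow> real) \<Rightarrow> real" where
  "schwartz_seminorm k n \<phi> = (SUP x. \<bar>x ^ k * (deriv ^^ n) \<phi> x\<bar>)"

text \<open>A tempered distribution is a linear functional on the Schwartz space that is continuous for
  the locally convex topology of the family of seminorms above, that is, bounded by a multiple of
  a finite sum of them. Extensionality makes equality of tempered distributions agree with equality
  of functions in HOL.\<close>

definition tempered_distribution :: "((real \<Rightarrow> real) \<Rightarrow> real) set" where
  "tempered_distribution = {T \<in> extensional schwartz.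
     (\<forall>\<phi>\<in>schwartz. \<forall>\<psi>\<in>schwartz. \<forall>a b.
        T (\<lambda>x. a * \<phi> x + b * \<psi> x) = a * T \<phi> + b * T \<psi>) \<and>
     (\<exists>C N. \<forall>\<phi>\<in>schwartz. \<bar>T \<phi>\<bar> \<le> C * (\<Sum>k\<le>N. \<Sum>n\<le>N. schwartz_seminorm k n \<phi>))}"

definition distr_deriv :: "((real \<Rightarrow> real) \<Rightarrow> real) \<Rightarrow> (real \<Rightarrow> real) \<Rightarrow> real" where
  "distr_deriv T = (\<lambda>\<phi>\<in>schwartz. - T (deriv \<phi>))"

definition represented_by :: "((real \<Rightarrow> real) \<Rightarrow> real) \<Rightarrow> (real \<Rightarrow> real) \<Rightarrow> bool" where
  "represented_by T g \<longleftrightarrow>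
     (\<forall>\<phi>\<in>schwartz. integrable lborel (\<lambda>t. g t * \<phi> t) \<and> T \<phi> = (LINT t|lborel. g t * \<phi> t))"

text \<open>The value at \<open>x\<close> of a distribution that is a continuous function. The continuous
  representative is unique whenever it exists, and it exists on the space \<open>BV2\<close> below.\<close>

definition point_value :: "((real \<Rightarrow> real) \<Rightarrow> real) \<Rightarrow> real \<Rightarrow> real" where
  "point_value T = (THE g. continuous_on UNIV g \<and> represented_by T g)"


section \<open>Bounded Radon measures on the real line\<close>

text \<open>Finite signed Borel measures as real-valued, countably additive set functions. On the real line
  regularity is automatic, so these are exactly the bounded Radon measures.\<close>

definition bounded_radon_measure :: "(real set \<Rightarrow> real) set" where
  "bounded_radon_measure = {\<mu> \<in> extensional (sets borel).
     \<forall>A :: nat \<Rightarrow> real set. range A \<subseteq> sets borel \<longrightarrow> disjoint_family A \<longrightarrow>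
       (\<lambda>i. \<mu> (A i)) sums \<mu> (\<Union>i. A i)}"

text \<open>The supremum below is that of a bounded set, since a finite signed measure has finite total
  variation.\<close>

definition total_variation :: "(real set \<Rightarrow> real) \<Rightarrow> real" where
  "total_variation \<mu> =
     (SUP P\<in>{P. finite P \<and> P \<subseteq> sets borel \<and> disjoint P}. \<Sum>A\<in>P. \<bar>\<mu> A\<bar>)"

text \<open>The positive part of the Jordan decomposition; the negative part of \<open>\<mu>\<close> is the positive
  part of \<open>- \<mu>\<close>.\<close>

definition positive_part :: "(real set \<Rightarrow> real) \<Rightarrow> real measure" where
  "positive_part \<mu> =
     measure_of UNIV (sets borel) (\<lambda>A. ennreal (SUP B\<in>{B \<in> sets borel. B \<subseteq> A}. \<mu> B))"

definition signed_integral :: "(real set \<Rightarrow> real) \<Rightarrow> (real \<Rightarrow> real) \<Rightarrow> real" where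
  "signed_integral \<mu> \<phi> =
     (LINT t|positive_part \<mu>. \<phi> t) - (LINT t|positive_part (\<lambda>A. - \<mu> A). \<phi> t)"

definition measure_distr :: "(real set \<Rightarrow> real) \<Rightarrow> (real \<Rightarrow> real) \<Rightarrow> real" where
  "measure_distr \<mu> = (\<lambda>\<phi>\<in>schwartz. signed_integral \<mu> \<phi>)"

text \<open>The norm of a distribution that is a bounded Radon measure; the measure is determined by the
  distribution.\<close>

definition norm_M :: "((real \<Rightarrow> real) \<Rightarrow> real) \<Rightarrow> real" where
  "norm_M w = total_variation (THE \<mu>. \<mu> \<in> bounded_radon_measure \<and> measure_distr \<mu> = w)"


section \<open>The regularized problem\<close>

definition BV2 :: "((real \<Rightarrow> real) \<Rightarrow> real) set" where
  "BV2 = {f \<in> tempered_distribution.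
            distr_deriv (distr_deriv f) \<in> measure_distr ` bounded_radon_measure}"

definition gblasso_cost ::
  "(real \<Rightarrow> real \<Rightarrow> real) \<Rightarrow> real \<Rightarrow> nat \<Rightarrow> (nat \<Rightarrow> real) \<Rightarrow> (nat \<Rightarrow> real)
     \<Rightarrow> ((real \<Rightarrow> real) \<Rightarrow> real) \<Rightarrow> real" where
  "gblasso_cost E lam M x y f =
     (\<Sum>m=1..M. E (point_value f (x m)) (y m)) + lam * norm_M (distr_deriv (distr_deriv f))"

definition gblasso_solutions ::
  "(real \<Rightarrow> real \<Rightarrow> real) \<Rightarrow> real \<Rightarrow> nat \<Rightarrow> (nat \<Rightarrow> real) \<Rightarrow> (nat \<Rightarrow> real)
     \<Rightarrow> ((real \<Rightarrow> real) \<Rightarrow> real) set" where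
  "gblasso_solutions E lam M x y =
     {f. is_arg_min (gblasso_cost E lam M x y) (\<lambda>f. f \<in> BV2) f}"

definition strictly_convex :: "(real \<Rightarrow> real) \<Rightarrow> bool" where
  "strictly_convex h \<longleftrightarrow>
     (\<forall>s t u. s \<noteq> t \<longrightarrow> 0 < u \<longrightarrow> u < 1 \<longrightarrow>
        h ((1 - u) * s + u * t) < (1 - u) * h s + u * h t)"

definition coercive :: "(real \<Rightarrow> real) \<Rightarrow> bool" where
  "coercive h \<longleftrightarrow> filterlim h at_top at_infinity"

end

theory Submission
  imports Defs "HOL-Computational_Algebra.Polynomial"
begin

text \<open>The infinite-dimensional problem reduces to a strictly convex one for the values at the nodes.
  For values \<open>z\<close> let \<open>J z\<close> (\<open>kink_sum\<close>) be the sum of the absolute slope changes of the polygon through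
  the points \<open>(x m, z m)\<close>. Two facts carry the proof. Every \<open>f\<close> in \<open>BV2\<close> with values \<open>z\<close> at the nodes
  has \<open>\<parallel>D\<^sup>2 f\<parallel> \<ge> J z\<close> (\<open>kink_sum_le_norm_M\<close>), and for every \<open>z\<close> the polygon itself attains equality
  (\<open>piecewise_linear_interpolant\<close>). Hence the minimal cost over \<open>BV2\<close> is the minimum over \<open>z\<close> of
  \<open>G z = (\<Sum>m. E (z m) (y m)) + \<lambda> J z\<close>. This \<open>G\<close> is continuous and coercive in the values
  at the nodes, so a minimizer \<open>z\<^sub>0\<close> exists; as \<open>J\<close> is convex and \<open>E\<close> strictly convex in its
  first argument, the minimizer is unique at the nodes.
  A function \<open>f\<close> is then optimal if and only if it takes the values \<open>z\<^sub>0\<close> at the nodes and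
  \<open>\<parallel>D\<^sup>2 f\<parallel> = J z\<^sub>0\<close>, and \<open>J z\<^sub>0\<close> is also the minimum of the norm among the interpolants of \<open>z\<^sub>0\<close>. This gives
  both claims, including that there is an optimal function at all.

  The lower bound needs a description of \<open>BV2\<close>. If \<open>D\<^sup>2 f = \<mu>\<close> then, up to an affine function, \<open>f\<close> is
  the potential \<open>t \<mapsto> \<integral> (max 0 (t - s) - max 0 (- s)) d\<mu>(s)\<close> (\<open>BV2_representation\<close>): by Fubini the
  potential has second derivative \<open>\<mu>\<close>, and a functional whose second derivative vanishes is affine,
  because a Schwartz function with vanishing mean and first moment is a second derivative of a
  Schwartz function. Slopes of \<open>f\<close> between neighbouring nodes are thus integrals of slopes of ramps,
  and a ramp, being convex with slopes between \<open>0\<close> and \<open>1\<close>, has total slope variation at most \<open>1\<close>.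

  Integrals against the signed measure \<open>\<mu>\<close> are handled through a Hahn decomposition. Explicit smooth
  bump functions show that a continuous function and a bounded measure are determined by the
  distributions they define, so that \<open>point_value\<close> and \<open>norm_M\<close> mean what they should.\<close>

section \<open>Hahn decomposition and polar form of a finite signed measure\<close>

definition countably_additive_on :: "'a measure \<Rightarrow> ('a set \<Rightarrow> real) \<Rightarrow> bool" where
  "countably_additive_on M \<mu> \<longleftrightarrow> (\<forall>A :: nat \<Rightarrow> 'a set. range A \<subseteq> sets M \<longrightarrow> disjoint_family A \<longrightarrow>
     (\<lambda>i. \<mu> (A i)) sums \<mu> (\<Union>i. A i))"

definition totally_positive :: "'a measure \<Rightarrow> ('a set \<Rightarrow> real) \<Rightarrow> 'a set \<Rightarrow> bool" where
  "totally_positive M \<mu> P \<longleftrightarrow> P \<in> sets M \<and> (\<forall>B\<in>sets M. B \<subseteq> P \<longrightarrow> 0 \<le> \<mu> B)"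

context
  fixes M :: "'a measure" and \<mu> :: "'a set \<Rightarrow> real"
  assumes ca: "countably_additive_on M \<mu>"
begin

lemma signed_sums:
  fixes A :: "nat \<Rightarrow> 'a set"
  shows "range A \<subseteq> sets M \<Longrightarrow> disjoint_family A \<Longrightarrow> (\<lambda>i. \<mu> (A i)) sums \<mu> (\<Union>i. A i)"
  using ca unfolding countably_additive_on_def by blast

lemma signed_empty: "\<mu> {} = 0"
proof -
  have "(\<lambda>i::nat. \<mu> {}) sums \<mu> {}"
    using signed_sums[of "\<lambda>_. {}"] by (simp add: disjoint_family_on_def)
  then have "summable (\<lambda>i::nat. \<mu> {})"
    by (rule sums_summable)
  then show ?thesis
    by (simp add: summable_const_iff)
qed

lemma signed_Un:
  assumes "A \<in> sets M" "B \<in> sets M" "A \<inter> B = {}"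
  shows "\<mu> (A \<union> B) = \<mu> A + \<mu> B"
proof -
  define C where "C = (\<lambda>i::nat. if i = 0 then A else if i = 1 then B else {})"
  have C: "range C \<subseteq> sets M" "disjoint_family C" "(\<Union>i. C i) = A \<union> B"
    using assms by (auto simp: C_def disjoint_family_on_def split: if_splits)
  have "(\<lambda>i. \<mu> (C i)) sums (\<Sum>i\<in>{0,1}. \<mu> (C i))"
    by (rule sums_finite) (auto simp: C_def signed_empty)
  moreover have "(\<Sum>i\<in>{0,1}. \<mu> (C i)) = \<mu> A + \<mu> B"
    by (simp add: C_def)
  ultimately show ?thesis
    using signed_sums[OF C(1,2)] C(3) sums_unique2 by metis
qed

lemma signed_Diff:
  assumes "A \<in> sets M" "B \<in> sets M" "B \<subseteq> A"
  shows "\<mu> (A - B) = \<mu> A - \<mu> B"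
proof -
  have "(A - B) \<inter> B = {}" "(A - B) \<union> B = A" using assms by auto
  then show ?thesis using signed_Un[of "A - B" B] assms by simp
qed

lemma signed_split:
  assumes "A \<in> sets M" "P \<in> sets M"
  shows "\<mu> A = \<mu> (A \<inter> P) + \<mu> (A - P)"
proof -
  have "(A \<inter> P) \<inter> (A - P) = {}" "(A \<inter> P) \<union> (A - P) = A" by auto
  then show ?thesis using signed_Un[of "A \<inter> P" "A - P"] assms by simp
qed

text \<open>The classical exhaustion: each step removes a subset whose measure is at most the larger of \<open>- 1\<close> and
  half of the (possibly infinite) infimum over all subsets. The measures of the removed sets are
  summable, hence tend to \<open>0\<close>, so no subset of negative measure survives.\<close>

lemma totally_positive_subset:
  assumes A: "A \<in> sets M"
  obtains P where "totally_positive M \<mu> P" "P \<subseteq> A" "\<mu> A \<le> \<mu> P"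
proof -
  define good where "good A B \<longleftrightarrow> B \<in> sets M \<and> B \<subseteq> A \<and> \<mu> B \<le> 0 \<and>
      (\<forall>C\<in>sets M. C \<subseteq> A \<longrightarrow> \<mu> C < 0 \<longrightarrow> \<mu> B \<le> max (\<mu> C / 2) (- 1))" for A B
  have ex: "\<exists>B. good A B" for A
  proof (cases "\<exists>C\<in>sets M. C \<subseteq> A \<and> \<mu> C < -1")
    case True
    then obtain C where "C \<in> sets M" "C \<subseteq> A" "\<mu> C < -1" by blast
    then have "good A C" unfolding good_def by auto
    then show ?thesis ..
  next
    case False
    define S where "S = \<mu> ` {C \<in> sets M. C \<subseteq> A}"
    have S: "S \<noteq> {}" "bdd_below S"
      using False by (auto simp: S_def not_less intro!: bdd_belowI[of _ "-1"])
    have S0: "Inf S \<le> 0"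
      using signed_empty S by (intro cInf_lower) (auto simp: S_def image_iff intro!: exI[of _ "{}"])
    show ?thesis
    proof (cases "Inf S = 0")
      case True
      then have "\<mu> C \<ge> 0" if "C \<in> sets M" "C \<subseteq> A" for C
        using cInf_lower[OF _ S(2), of "\<mu> C"] that by (auto simp: S_def)
      then have "good A {}" unfolding good_def using signed_empty by fastforce
      then show ?thesis ..
    next
      case neg: False
      then have "Inf S < Inf S / 2" using S0 by auto
      then obtain B where B: "B \<in> sets M" "B \<subseteq> A" "\<mu> B < Inf S / 2"
        using cInf_lessD[OF S(1), of "Inf S / 2"] by (auto simp: S_def)
      have "\<mu> B \<le> max (\<mu> C / 2) (- 1)" if "C \<in> sets M" "C \<subseteq> A" for C
        using cInf_lower[OF _ S(2), of "\<mu> C"] that B by (auto simp: S_def)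
      then have "good A B" unfolding good_def using B S0 by auto
      then show ?thesis ..
    qed
  qed
  define pick where "pick A = (SOME B. good A B)" for A
  have pick: "good A (pick A)" for A
    unfolding pick_def using ex by (rule someI_ex)
  define R where "R = rec_nat A (\<lambda>_ A. A - pick A)"
  have R0: "R 0 = A" and RS: "R (Suc n) = R n - pick (R n)" for n
    by (simp_all add: R_def)
  have Rm: "R n \<in> sets M" for n
    by (induction n) (use A pick in \<open>auto simp: R0 RS good_def\<close>)
  have dec: "R n \<subseteq> R m" if "m \<le> n" for m n
    using that by (induction rule: dec_induct) (auto simp: RS)
  define B where "B n = pick (R n)" for n
  have Bm: "B n \<in> sets M" "B n \<subseteq> R n" "\<mu> (B n) \<le> 0" for n
    using pick[of "R n"] by (auto simp: B_def good_def)
  have disj: "disjoint_family B"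
  proof -
    have "B m \<inter> B n = {}" if "m < n" for m n
    proof -
      have "B n \<subseteq> R (Suc m)" using Bm(2)[of n] dec[of "Suc m" n] that by auto
      then show ?thesis by (auto simp: RS B_def)
    qed
    then show ?thesis
      unfolding disjoint_family_on_def by (metis linorder_neqE_nat Int_commute)
  qed
  have sumsB: "(\<lambda>n. \<mu> (B n)) sums \<mu> (\<Union>n. B n)"
    using Bm disj by (intro signed_sums) auto
  define P where "P = A - (\<Union>n. B n)"
  have Um: "(\<Union>n. B n) \<in> sets M" using Bm by auto
  have UA: "(\<Union>n. B n) \<subseteq> A" using Bm(2) dec[of 0] R0 by blast
  have PR: "P \<subseteq> R n" for n
    by (induction n) (auto simp: P_def R0 RS B_def)
  have "\<mu> (\<Union>n. B n) \<le> 0"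
    using sums_le[OF _ sumsB sums_zero] Bm(3) by auto
  then have le: "\<mu> A \<le> \<mu> P"
    unfolding P_def using signed_Diff[OF A Um UA] by simp
  have "0 \<le> \<mu> C" if C: "C \<in> sets M" "C \<subseteq> P" for C
  proof (rule ccontr)
    assume "\<not> 0 \<le> \<mu> C"
    then have "\<mu> (B n) \<le> max (\<mu> C / 2) (- 1)" for n
      using pick[of "R n"] C PR[of n] unfolding good_def B_def by auto
    moreover have "(\<lambda>n. \<mu> (B n)) \<longlonglongrightarrow> 0"
      using sumsB by (intro summable_LIMSEQ_zero) (rule sums_summable)
    ultimately have "0 \<le> max (\<mu> C / 2) (- 1)"
      by (intro LIMSEQ_le_const2) auto
    with \<open>\<not> 0 \<le> \<mu> C\<close> show False by auto
  qed
  then have "totally_positive M \<mu> P"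
    unfolding totally_positive_def P_def using A Um by auto
  with le show thesis by (intro that[of P]) (auto simp: P_def)
qed

text \<open>A totally positive set of maximal measure leaves no positive mass outside: by the previous lemma
  any such mass would contain a totally positive set, which could be added to it.\<close>

lemma Hahn_decomposition:
  obtains P where "P \<in> sets M" "\<And>B. B \<in> sets M \<Longrightarrow> B \<subseteq> P \<Longrightarrow> 0 \<le> \<mu> B"
    "\<And>B. B \<in> sets M \<Longrightarrow> B \<inter> P = {} \<Longrightarrow> \<mu> B \<le> 0"
proof -
  define T where "T = {P. totally_positive M \<mu> P}"
  have T0: "{} \<in> T" by (auto simp: T_def totally_positive_def signed_empty)
  have mono: "\<mu> Q \<le> \<mu> P" if "P \<in> T" "Q \<in> sets M" "Q \<subseteq> P" for P Q
  proof -
    have "0 \<le> \<mu> (P - Q)" using that by (auto simp: T_def totally_positive_def)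
    then show ?thesis using signed_Diff[of P Q] that by (auto simp: T_def totally_positive_def)
  qed
  have UnT: "(\<Union>n. F n) \<in> T" if F: "range F \<subseteq> T" for F :: "nat \<Rightarrow> 'a set"
  proof -
    have Fm: "F n \<in> sets M" for n using F by (auto simp: T_def totally_positive_def)
    have "0 \<le> \<mu> B" if B: "B \<in> sets M" "B \<subseteq> (\<Union>n. F n)" for B
    proof -
      define D where "D n = B \<inter> disjointed F n" for n
      have Dm: "D n \<in> sets M" for n
        using B Fm sets.range_disjointed_sets[of F M] by (auto simp: D_def)
      have "disjoint_family D"
        using disjoint_family_disjointed[of F] by (auto simp: D_def disjoint_family_on_def)
      moreover have "(\<Union>n. D n) = B"
        using B UN_disjointed_eq[of F] by (auto simp: D_def)
      ultimately have s: "(\<lambda>n. \<mu> (D n)) sums \<mu> B"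
        using signed_sums[of D] Dm by auto
      have "0 \<le> \<mu> (D n)" for n
      proof -
        have "F n \<in> T" "D n \<subseteq> F n" using F disjointed_subset[of F n] by (auto simp: D_def)
        then show ?thesis using Dm[of n] by (auto simp: T_def totally_positive_def)
      qed
      then show ?thesis using s sums_le[OF _ sums_zero s] by auto
    qed
    then show ?thesis using Fm by (auto simp: T_def totally_positive_def)
  qed
  have "\<exists>P\<in>T. \<forall>Q\<in>T. \<mu> Q \<le> \<mu> P"
  proof -
    have "\<exists>F :: nat \<Rightarrow> 'a set. range F \<subseteq> T \<and> (\<forall>Q\<in>T. \<forall>e>0. \<exists>n. \<mu> Q - e \<le> \<mu> (F n))"
    proof (cases "bdd_above (\<mu> ` T)")
      case True
      have "\<exists>P\<in>T. Sup (\<mu> ` T) - inverse (real (Suc n)) < \<mu> P" for n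
        using less_cSup_iff[of "\<mu> ` T" "Sup (\<mu> ` T) - inverse (real (Suc n))"] T0 True by auto
      then obtain F where F: "\<And>n. F n \<in> T" "\<And>n. Sup (\<mu> ` T) - inverse (real (Suc n)) < \<mu> (F n)"
        by metis
      have "\<exists>n. \<mu> Q - e \<le> \<mu> (F n)" if Q: "Q \<in> T" and "e > 0" for Q e
      proof -
        obtain n where "inverse (real (Suc n)) < e" using reals_Archimedean[OF \<open>e > 0\<close>] by auto
        moreover have "\<mu> Q \<le> Sup (\<mu> ` T)" using Q True by (intro cSup_upper) auto
        ultimately show ?thesis using F(2)[of n] by (intro exI[of _ n]) linarith
      qed
      then show ?thesis using F by blast
    next
      case False
      then have "\<exists>P\<in>T. real n < \<mu> P" for n
        unfolding bdd_above_def by (force simp: not_le)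
      then obtain F where F: "\<And>n. F n \<in> T" "\<And>n. real n < \<mu> (F n)"
        by metis
      have "\<exists>n. \<mu> Q - e \<le> \<mu> (F n)" if "e > 0" for Q e
      proof -
        obtain n where "\<mu> Q \<le> real n" using real_arch_simple by blast
        then show ?thesis using F(2)[of n] that by (intro exI[of _ n]) linarith
      qed
      then show ?thesis using F by blast
    qed
    then obtain F :: "nat \<Rightarrow> 'a set" where F: "range F \<subseteq> T" "\<And>Q e. Q \<in> T \<Longrightarrow> e > 0 \<Longrightarrow> \<exists>n. \<mu> Q - e \<le> \<mu> (F n)"
      by blast
    have "\<mu> Q \<le> \<mu> (\<Union>n. F n)" if Q: "Q \<in> T" for Q
    proof (rule field_le_epsilon)
      fix e :: real assume "e > 0"
      then obtain n where "\<mu> Q - e \<le> \<mu> (F n)" using F(2)[OF Q \<open>e > 0\<close>] by blast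
      also have "\<dots> \<le> \<mu> (\<Union>n. F n)"
        using UnT[OF F(1)] F(1) by (intro mono) (auto simp: T_def totally_positive_def)
      finally show "\<mu> Q \<le> \<mu> (\<Union>n. F n) + e" by simp
    qed
    then show ?thesis using UnT[OF F(1)] by blast
  qed
  then obtain P where P: "P \<in> T" "\<And>Q. Q \<in> T \<Longrightarrow> \<mu> Q \<le> \<mu> P" by blast
  have Pm: "P \<in> sets M" using P by (auto simp: T_def totally_positive_def)
  have "\<mu> B \<le> 0" if B: "B \<in> sets M" "B \<inter> P = {}" for B
  proof -
    obtain Q where Q: "totally_positive M \<mu> Q" "Q \<subseteq> B" "\<mu> B \<le> \<mu> Q"
      using totally_positive_subset[OF B(1)] by blast
    have "range (\<lambda>n::nat. if n = 0 then P else Q) \<subseteq> T" using P Q by (auto simp: T_def)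
    moreover have "(\<Union>n::nat. if n = 0 then P else Q) = P \<union> Q"
      by (auto split: if_splits intro: exI[of _ "Suc 0"])
    ultimately have "P \<union> Q \<in> T" using UnT[of "\<lambda>n::nat. if n = 0 then P else Q"] by simp
    then have "\<mu> (P \<union> Q) \<le> \<mu> P" by (rule P)
    moreover have "\<mu> (P \<union> Q) = \<mu> P + \<mu> Q"
      using Q B Pm by (intro signed_Un) (auto simp: totally_positive_def)
    ultimately show ?thesis using Q by simp
  qed
  then show thesis using P Pm by (intro that[of P]) (auto simp: T_def totally_positive_def)
qed

end

text \<open>Writing \<open>\<mu> = \<sigma> \<nu>\<close> with \<open>\<nu>\<close> the variation of \<open>\<mu>\<close>, a finite positive measure, and \<open>\<sigma>\<close> a sign merges the
  integrals against the two Jordan parts into a single one against \<open>\<nu>\<close>; Fubini and dominated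
  convergence then apply to one positive measure.\<close>

locale polar_form = finite_measure \<nu> for \<nu> :: "real measure" +
  fixes \<mu> :: "real set \<Rightarrow> real" and \<sigma> :: "real \<Rightarrow> real"
  assumes sets_variation [measurable_cong, simp]: "sets \<nu> = sets borel"
    and sign_measurable [measurable]: "\<sigma> \<in> borel_measurable borel"
    and abs_sign: "\<bar>\<sigma> t\<bar> = 1"
    and measure_eq: "A \<in> sets borel \<Longrightarrow> \<mu> A = (LINT t|\<nu>. \<sigma> t * indicator A t)"
    and total_variation_eq: "total_variation \<mu> = measure \<nu> UNIV"
    and signed_integral_eq: "\<phi> \<in> borel_measurable borel \<Longrightarrow> bounded (range \<phi>) \<Longrightarrow>
       signed_integral \<mu> \<phi> = (LINT t|\<nu>. \<sigma> t * \<phi> t)"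

lemma (in polar_form) space_variation [simp]: "space \<nu> = UNIV"
  using sets_eq_imp_space_eq[OF sets_variation] by simp

text \<open>With a Hahn set \<open>P\<close>, the supremum of \<open>\<mu>\<close> over the subsets of \<open>A\<close> is attained at \<open>A \<inter> P\<close>, that of
  \<open>- \<mu>\<close> at \<open>A - P\<close>, and that of the partition sums at the partition into \<open>P\<close> and its complement. So the
  Jordan parts and the total variation are all read off from \<open>\<mu> (A \<inter> P) - \<mu> (A - P)\<close>.\<close>

lemma polar_decomposition:
  assumes "\<mu> \<in> bounded_radon_measure"
  obtains \<nu> \<sigma> where "polar_form \<nu> \<mu> \<sigma>"
proof -
  have ca: "countably_additive_on borel \<mu>"
    using assms by (auto simp: countably_additive_on_def bounded_radon_measure_def)
  obtain P where P: "P \<in> sets borel" "\<And>B. B \<in> sets borel \<Longrightarrow> B \<subseteq> P \<Longrightarrow> 0 \<le> \<mu> B"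
    "\<And>B. B \<in> sets borel \<Longrightarrow> B \<inter> P = {} \<Longrightarrow> \<mu> B \<le> 0"
    using Hahn_decomposition[OF ca] by metis
  have pos: "0 \<le> \<mu> (A \<inter> P)" and neg: "\<mu> (A - P) \<le> 0" if "A \<in> sets borel" for A
    using that P(1) by (auto intro!: P(2,3))
  have disjP: "A \<inter> P \<inter> P = A \<inter> P" "A - P - P = A - P" "(A - P) \<inter> P = {}" "A \<inter> P - P = {}" for A
    by auto
  define v where "v A = \<mu> (A \<inter> P) - \<mu> (A - P)" for A
  have v0: "0 \<le> v A" if "A \<in> sets borel" for A
    using pos[OF that] neg[OF that] by (simp add: v_def)
  define \<nu> where "\<nu> = measure_of UNIV (sets borel) (\<lambda>A. ennreal (v A))"
  have sets\<nu>[measurable_cong, simp]: "sets \<nu> = sets borel"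
    unfolding \<nu>_def using sets.sets_measure_of_eq[of borel] by (simp)
  have sp[simp]: "space \<nu> = UNIV" by (simp add: \<nu>_def space_measure_of_conv)
  have sums_v: "(\<lambda>i. v (A i)) sums v (\<Union>i. A i)"
    if A: "range A \<subseteq> sets borel" "disjoint_family A" for A :: "nat \<Rightarrow> real set"
  proof -
    have "(\<lambda>i. \<mu> (A i \<inter> P)) sums \<mu> (\<Union>i. A i \<inter> P)"
      using A P(1) by (intro signed_sums[OF ca]) (auto simp: disjoint_family_on_def)
    moreover have "(\<lambda>i. \<mu> (A i - P)) sums \<mu> (\<Union>i. A i - P)"
      using A P(1) by (intro signed_sums[OF ca]) (auto simp: disjoint_family_on_def)
    moreover have "(\<Union>i. A i \<inter> P) = (\<Union>i. A i) \<inter> P" "(\<Union>i. A i - P) = (\<Union>i. A i) - P" by auto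
    ultimately show ?thesis unfolding v_def by (auto intro: sums_diff)
  qed
  have em: "emeasure \<nu> A = ennreal (v A)" if "A \<in> sets borel" for A
    unfolding \<nu>_def
  proof (rule emeasure_measure_of_sigma[OF _ _ _ that])
    show "sigma_algebra UNIV (sets (borel :: real measure))"
      using sets.sigma_algebra_axioms[of "borel :: real measure"] by simp
    show "positive (sets borel) (\<lambda>A. ennreal (v A))"
      by (auto simp: positive_def v_def signed_empty[OF ca])
    show "countably_additive (sets borel) (\<lambda>A. ennreal (v A))"
      unfolding countably_additive_def
    proof (intro allI impI)
      fix A :: "nat \<Rightarrow> real set"
      assume A: "range A \<subseteq> sets borel" "disjoint_family A" "\<Union> (range A) \<in> sets borel"
      show "(\<Sum>i. ennreal (v (A i))) = ennreal (v (\<Union> (range A)))"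
        using A v0 sums_v[OF A(1,2)] by (intro suminf_ennreal_eq) auto
    qed
  qed
  have fin: "finite_measure \<nu>" by (rule finite_measureI) (simp add: em)
  interpret finite_measure \<nu> by (rule fin)
  have me: "measure \<nu> A = v A" if "A \<in> sets borel" for A
    using em[OF that] v0[OF that] by (simp add: measure_def)
  define \<sigma> :: "real \<Rightarrow> real" where "\<sigma> t = indicator P t - indicator (- P) t" for t
  have \<sigma>m[measurable]: "\<sigma> \<in> borel_measurable borel"
    unfolding \<sigma>_def using P(1) by measurable
  have \<sigma>1: "\<bar>\<sigma> t\<bar> = 1" for t by (auto simp: \<sigma>_def indicator_def)
  have rep: "\<mu> A = (LINT t|\<nu>. \<sigma> t * indicator A t)" if A[measurable]: "A \<in> sets borel" for A
  proof -
    have "(LINT t|\<nu>. \<sigma> t * indicator A t) = (LINT t|\<nu>. indicator (A \<inter> P) t - indicator (A - P) t)"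
      by (intro Bochner_Integration.integral_cong) (auto simp: \<sigma>_def indicator_def)
    also have "\<dots> = measure \<nu> (A \<inter> P) - measure \<nu> (A - P)"
      using P(1) A by (subst Bochner_Integration.integral_diff) (auto simp: em less_top[symmetric])
    also have "\<dots> = \<mu> A"
      using P(1) A signed_split[OF ca A P(1)] signed_empty[OF ca]
      by (simp add: me v_def disjP del: Int_Diff Diff_Diff_Int)
    finally show ?thesis ..
  qed
  have tv: "total_variation \<mu> = measure \<nu> UNIV"
    unfolding total_variation_def
  proof (rule cSup_eq_maximum)
    have "disjoint {P, - P}" by (auto simp: disjoint_def)
    moreover have "(\<Sum>A\<in>{P, - P}. \<bar>\<mu> A\<bar>) = measure \<nu> UNIV"
    proof -
      have "P \<noteq> - P" by auto
      then show ?thesis using P(1) pos[of UNIV] neg[of UNIV] by (simp add: me v_def Compl_eq_Diff_UNIV)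
    qed
    ultimately show "measure \<nu> UNIV \<in> (\<lambda>Pa. \<Sum>A\<in>Pa. \<bar>\<mu> A\<bar>) ` {P. finite P \<and> P \<subseteq> sets borel \<and> disjoint P}"
      using P(1) by (auto simp: image_iff intro!: exI[of _ "{P, - P}"])
  next
    fix r assume "r \<in> (\<lambda>Pa. \<Sum>A\<in>Pa. \<bar>\<mu> A\<bar>) ` {P. finite P \<and> P \<subseteq> sets borel \<and> disjoint P}"
    then obtain Q where Q: "finite Q" "Q \<subseteq> sets borel" "disjoint Q" "r = (\<Sum>A\<in>Q. \<bar>\<mu> A\<bar>)"
      by auto
    have "\<bar>\<mu> A\<bar> \<le> measure \<nu> A" if "A \<in> sets borel" for A
      using pos[OF that] neg[OF that] signed_split[OF ca that P(1)] that by (simp add: me v_def)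
    then have "r \<le> (\<Sum>A\<in>Q. measure \<nu> A)"
      using Q by (auto intro!: sum_mono)
    also have "\<dots> = measure \<nu> (\<Union>A\<in>Q. A)"
      using Q by (intro measure_finite_Union[symmetric])
        (auto simp: disjoint_family_on_def disjoint_def em)
    also have "\<dots> \<le> measure \<nu> UNIV"
      by (intro finite_measure_mono) auto
    finally show "r \<le> measure \<nu> UNIV" .
  qed
  have pp: "positive_part \<mu> = density \<nu> (indicator P)"
    and pn: "positive_part (\<lambda>A. - \<mu> A) = density \<nu> (indicator (- P))"
  proof -
    have *: "measure_of UNIV (sets borel) w = density \<nu> (indicator Q)"
      if w: "\<And>A. A \<in> sets borel \<Longrightarrow> w A = emeasure \<nu> (A \<inter> Q)" and Q[measurable]: "Q \<in> sets borel" for w Q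
    proof -
      have "measure_of UNIV (sets borel) w = measure_of UNIV (sets borel) (emeasure (density \<nu> (indicator Q)))"
      proof (rule measure_of_eq)
        fix a :: "real set" assume "a \<in> sigma_sets UNIV (sets borel)"
        then have a: "a \<in> sets borel"
          using sets.sigma_sets_eq[of "borel :: real measure"] by simp
        then have "emeasure (density \<nu> (indicator Q)) a = emeasure \<nu> (a \<inter> Q)"
          by (subst emeasure_density) (auto simp: nn_integral_indicator[symmetric] indicator_def
              simp del: nn_integral_indicator intro!: nn_integral_cong)
        then show "w a = emeasure (density \<nu> (indicator Q)) a" using w[OF a] by simp
      qed simp
      also have "\<dots> = density \<nu> (indicator Q)"
        using measure_of_of_measure[of "density \<nu> (indicator Q)"] by simp
      finally show ?thesis .
    qed
    have sup1: "(SUP B\<in>{B \<in> sets borel. B \<subseteq> A}. \<mu> B) = v (A \<inter> P)" if A: "A \<in> sets borel" for A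
    proof (rule cSup_eq_maximum)
      have "v (A \<inter> P) = \<mu> (A \<inter> P)" by (simp add: v_def disjP signed_empty[OF ca] del: Int_Diff)
      then show "v (A \<inter> P) \<in> \<mu> ` {B \<in> sets borel. B \<subseteq> A}" using A P(1) by auto
    next
      fix r assume "r \<in> \<mu> ` {B \<in> sets borel. B \<subseteq> A}"
      then obtain B where B: "B \<in> sets borel" "B \<subseteq> A" "r = \<mu> B" by auto
      have "\<mu> B \<le> \<mu> (B \<inter> P)" using signed_split[OF ca B(1) P(1)] neg[OF B(1)] by simp
      also have "\<dots> \<le> \<mu> (A \<inter> P)"
      proof -
        have "B \<inter> P \<subseteq> A \<inter> P" "A \<inter> P - B \<inter> P \<subseteq> P" using B by auto
        then show ?thesis
          using signed_Diff[OF ca, of "A \<inter> P" "B \<inter> P"] P(2)[of "A \<inter> P - B \<inter> P"] A B P(1) by auto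
      qed
      finally show "r \<le> v (A \<inter> P)" using B by (simp add: v_def disjP signed_empty[OF ca] del: Int_Diff)
    qed
    have sup2: "(SUP B\<in>{B \<in> sets borel. B \<subseteq> A}. - \<mu> B) = v (A \<inter> - P)" if A: "A \<in> sets borel" for A
    proof (rule cSup_eq_maximum)
      have "v (A \<inter> - P) = - \<mu> (A - P)" by (simp add: v_def Int_assoc Diff_eq signed_empty[OF ca])
      then show "v (A \<inter> - P) \<in> (\<lambda>B. - \<mu> B) ` {B \<in> sets borel. B \<subseteq> A}" using A P(1) by auto
    next
      fix r assume "r \<in> (\<lambda>B. - \<mu> B) ` {B \<in> sets borel. B \<subseteq> A}"
      then obtain B where B: "B \<in> sets borel" "B \<subseteq> A" "r = - \<mu> B" by auto
      have "- \<mu> B \<le> - \<mu> (B - P)" using signed_split[OF ca B(1) P(1)] pos[OF B(1)] by simp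
      also have "\<dots> \<le> - \<mu> (A - P)"
      proof -
        have "B - P \<subseteq> A - P" "(A - P - (B - P)) \<inter> P = {}" using B by auto
        then show ?thesis
          using signed_Diff[OF ca, of "A - P" "B - P"] P(3)[of "(A - P) - (B - P)"] A B P(1) by auto
      qed
      finally show "r \<le> v (A \<inter> - P)" using B by (simp add: v_def Int_assoc Diff_eq signed_empty[OF ca])
    qed
    show "positive_part \<mu> = density \<nu> (indicator P)"
      unfolding positive_part_def using P(1) by (intro *) (auto simp: sup1 em)
    show "positive_part (\<lambda>A. - \<mu> A) = density \<nu> (indicator (- P))"
      unfolding positive_part_def using P(1) by (intro *) (auto simp: sup2 em)
  qed
  have si: "signed_integral \<mu> \<phi> = (LINT t|\<nu>. \<sigma> t * \<phi> t)"
    if \<phi>[measurable]: "\<phi> \<in> borel_measurable borel" and b: "bounded (range \<phi>)" for \<phi>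
  proof -
    obtain C where C: "\<And>t. \<bar>\<phi> t\<bar> \<le> C" using b by (auto simp: bounded_iff)
    have int: "integrable \<nu> (\<lambda>t. indicator Q t * \<phi> t)" if [measurable]: "Q \<in> sets borel" for Q
      using C by (intro integrable_const_bound[of _ C]) (auto simp: indicator_def intro: order_trans[OF abs_ge_zero])
    have "integral\<^sup>L (density \<nu> (indicator Q)) \<phi> = (LINT t|\<nu>. indicator Q t * \<phi> t)"
      if [measurable]: "Q \<in> sets borel" for Q
      using integral_real_density[of "indicator Q" \<nu> \<phi>] by (simp add: ennreal_indicator)
    then have "signed_integral \<mu> \<phi> = (LINT t|\<nu>. indicator P t * \<phi> t) - (LINT t|\<nu>. indicator (- P) t * \<phi> t)"
      unfolding signed_integral_def pp pn using P(1) by auto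
    also have "\<dots> = (LINT t|\<nu>. \<sigma> t * \<phi> t)"
      using int P(1) by (subst Bochner_Integration.integral_diff[symmetric]) (auto simp: \<sigma>_def algebra_simps)
    finally show ?thesis .
  qed
  show thesis
    by (rule that[OF polar_form.intro[OF fin polar_form_axioms.intro[OF sets\<nu> \<sigma>m \<sigma>1 rep tv si]]])
qed

section \<open>Smooth functions and Schwartz functions\<close>

text \<open>Counting the available derivatives makes the closure properties plain inductions on the order, with
  no formula for the higher derivatives of a product.\<close>

primrec times_differentiable :: "nat \<Rightarrow> (real \<Rightarrow> real) \<Rightarrow> bool" where
  "times_differentiable 0 f \<longleftrightarrow> True"
| "times_differentiable (Suc n) f \<longleftrightarrow> (\<forall>x. f differentiable at x) \<and> times_differentiable n (deriv f)"

lemma times_differentiable_iff: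
  "times_differentiable n f \<longleftrightarrow> (\<forall>k<n. \<forall>x. (deriv ^^ k) f differentiable at x)"
proof (induction n arbitrary: f)
  case (Suc n)
  then show ?case
    by (simp add: All_less_Suc2 funpow_Suc_right del: funpow.simps)
qed simp

lemma times_differentiable_SucI:
  assumes "\<And>x. (f has_real_derivative f' x) (at x)" "times_differentiable n f'"
  shows "times_differentiable (Suc n) f"
proof -
  have "deriv f = f'" using assms(1) by (auto intro!: ext DERIV_imp_deriv)
  then show ?thesis using assms by (auto simp: real_differentiable_def)
qed

lemma times_differentiable_mono: "times_differentiable (Suc n) f \<Longrightarrow> times_differentiable n f"
  by (simp add: times_differentiable_iff)

lemma times_differentiable_add:
  "times_differentiable n f \<Longrightarrow> times_differentiable n g \<Longrightarrow> times_differentiable n (\<lambda>x. f x + g x)"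
proof (induction n arbitrary: f g)
  case (Suc n)
  show ?case
    by (rule times_differentiable_SucI[where f' = "\<lambda>x. deriv f x + deriv g x"])
      (use Suc in \<open>auto intro!: DERIV_add simp: DERIV_deriv_iff_real_differentiable\<close>)
qed simp

lemma times_differentiable_mult:
  "times_differentiable n f \<Longrightarrow> times_differentiable n g \<Longrightarrow> times_differentiable n (\<lambda>x. f x * g x)"
proof (induction n arbitrary: f g)
  case (Suc n)
  have "times_differentiable n (\<lambda>x. deriv f x * g x + deriv g x * f x)"
    using Suc times_differentiable_mono by (intro times_differentiable_add Suc.IH) auto
  then show ?case
    by (rule times_differentiable_SucI[rotated])
      (use Suc.prems in \<open>auto intro!: DERIV_mult simp: DERIV_deriv_iff_real_differentiable\<close>)
qed simp

lemma times_differentiable_const: "times_differentiable n (\<lambda>x. c)"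
proof (induction n arbitrary: c)
  case (Suc n)
  show ?case by (rule times_differentiable_SucI[OF DERIV_const Suc])
qed simp

lemma times_differentiable_affine:
  "times_differentiable n f \<Longrightarrow> times_differentiable n (\<lambda>x. f (c * x + d))"
proof (induction n arbitrary: f)
  case (Suc n)
  have "((\<lambda>x. f (c * x + d)) has_real_derivative deriv f (c * x + d) * c) (at x)" for x
    using Suc.prems
    by (intro DERIV_chain2[where f = f and g = "\<lambda>x. c * x + d"])
      (auto intro!: derivative_eq_intros simp: DERIV_deriv_iff_real_differentiable)
  then show ?case
    by (rule times_differentiable_SucI) (use Suc in \<open>auto intro!: times_differentiable_mult times_differentiable_const\<close>)
qed simp

text \<open>Functions of the form \<open>P (1 / t) exp (- s / t)\<close>, extended by \<open>0\<close> to \<open>t \<le> 0\<close>, are closed under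
  differentiation; allowing the polynomial \<open>P\<close> is what makes the induction on the order go through.\<close>

definition flat :: "real poly \<Rightarrow> real \<Rightarrow> real \<Rightarrow> real" where
  "flat p s t = (if 0 < t then poly p (1 / t) * exp (- s / t) else 0)"

lemma poly_mult_exp_tendsto_0:
  fixes s :: real
  assumes "0 < s"
  shows "((\<lambda>u. poly p u * exp (- s * u)) \<longlongrightarrow> 0) at_top"
proof -
  have "((\<lambda>u. u ^ i * exp (- s * u)) \<longlongrightarrow> 0) at_top" for i
  proof -
    have "((\<lambda>u. (s * u) ^ i / exp (s * u)) \<longlongrightarrow> 0) at_top"
      by (rule filterlim_compose[OF tendsto_power_div_exp_0])
        (rule filterlim_tendsto_pos_mult_at_top[OF tendsto_const assms filterlim_ident])
    then have "((\<lambda>u. (1 / s ^ i) * ((s * u) ^ i / exp (s * u))) \<longlongrightarrow> (1 / s ^ i) * 0) at_top"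
      by (intro tendsto_intros)
    then show ?thesis
      using assms by (simp add: power_mult_distrib exp_minus field_simps)
  qed
  then have "((\<lambda>u. \<Sum>i\<le>degree p. coeff p i * (u ^ i * exp (- s * u))) \<longlongrightarrow> (\<Sum>i\<le>degree p. coeff p i * 0)) at_top"
    by (intro tendsto_intros)
  then show ?thesis
    by (simp add: poly_altdef sum_distrib_right mult.assoc)
qed

text \<open>At \<open>0\<close> the difference quotient is again of the form \<open>P (1 / t) exp (- s / t)\<close> on the right, and the
  exponential beats the polynomial.\<close>

lemma DERIV_flat:
  assumes "0 < s"
  shows "(flat p s has_real_derivative flat (monom 1 2 * (smult s p - pderiv p)) s t) (at t)"
proof -
  consider "t > 0" | "t < 0" | "t = 0" by linarith
  then show ?thesis
  proof cases
    case 1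
    have "((\<lambda>t. poly p (1 / t) * exp (- s / t)) has_real_derivative
        flat (monom 1 2 * (smult s p - pderiv p)) s t) (at t)"
      using 1
      by (auto intro!: derivative_eq_intros DERIV_chain2[where f = "poly p" and g = "\<lambda>t. 1 / t"] poly_DERIV
          simp: flat_def poly_monom field_simps power2_eq_square)
    moreover have "\<forall>\<^sub>F x in nhds t. flat p s x = poly p (1 / x) * exp (- s / x)"
      using eventually_nhds_in_open[of "{0<..}" t] 1 by (auto elim!: eventually_mono simp: flat_def)
    ultimately show ?thesis by (subst DERIV_cong_ev) auto
  next
    case 2
    have "\<forall>\<^sub>F x in nhds t. flat p s x = 0"
      using eventually_nhds_in_open[of "{..<0}" t] 2 by (auto elim!: eventually_mono simp: flat_def)
    then have "(flat p s has_real_derivative 0) (at t)"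
      by (subst DERIV_cong_ev[where g = "\<lambda>_. 0"]) auto
    then show ?thesis using 2 by (simp add: flat_def)
  next
    case 3
    have "((\<lambda>h. flat p s h / h) \<longlongrightarrow> 0) (at_right 0)"
    proof -
      have "((\<lambda>h. poly (pCons 0 p) (inverse h) * exp (- s * inverse h)) \<longlongrightarrow> 0) (at_right 0)"
        by (rule filterlim_compose[OF poly_mult_exp_tendsto_0[OF assms] filterlim_inverse_at_top_right])
      moreover have "\<forall>\<^sub>F h in at_right 0. poly (pCons 0 p) (inverse h) * exp (- s * inverse h) = flat p s h / h"
        using eventually_at_right_less[of 0] by eventually_elim (simp add: flat_def field_simps)
      ultimately show ?thesis by (rule Lim_transform_eventually)
    qed
    moreover have "((\<lambda>h. flat p s h / h) \<longlongrightarrow> 0) (at_left 0)"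
    proof -
      have "\<forall>\<^sub>F h::real in at_left 0. h < 0" by (simp add: eventually_at_filter)
      then have "\<forall>\<^sub>F h in at_left 0. 0 = flat p s h / h"
        by eventually_elim (simp add: flat_def)
      then show ?thesis by (rule Lim_transform_eventually[OF tendsto_const])
    qed
    ultimately have "((\<lambda>h. flat p s h / h) \<longlongrightarrow> 0) (at 0)"
      by (simp add: filterlim_at_split)
    then show ?thesis using 3 by (simp add: DERIV_def flat_def)
  qed
qed

lemma times_differentiable_flat: "0 < s \<Longrightarrow> times_differentiable n (flat p s)"
proof (induction n arbitrary: p)
  case (Suc n)
  show ?case by (rule times_differentiable_SucI[OF DERIV_flat[OF Suc.prems] Suc.IH[OF Suc.prems]])
qed simp

lemma schwartzI_compact_support:
  assumes f: "\<And>n. times_differentiable n f" and supp: "\<And>x. x \<notin> {a..b} \<Longrightarrow> f x = 0"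
  shows "f \<in> schwartz"
proof -
  have d: "(deriv ^^ n) f differentiable at x" for n x
    using f[of "Suc n"] unfolding times_differentiable_iff by blast
  have z: "(deriv ^^ n) f x = 0" if "x \<notin> {a..b}" for n x
    using that
  proof (induction n arbitrary: x)
    case (Suc n)
    have "\<forall>\<^sub>F y in nhds x. y \<in> - {a..b}"
      using Suc.prems by (intro eventually_nhds_in_open) auto
    then have "\<forall>\<^sub>F y in nhds x. (deriv ^^ n) f y = 0"
      by eventually_elim (use Suc.IH in auto)
    then have "((deriv ^^ n) f has_real_derivative 0) (at x)"
      by (subst DERIV_cong_ev[where g = "\<lambda>_. 0"]) auto
    then show ?case by (simp add: DERIV_imp_deriv)
  qed (use supp in auto)
  have "bounded (range (\<lambda>x. x ^ k * (deriv ^^ n) f x))" for k n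
  proof -
    have "continuous_on {a..b} (\<lambda>x. x ^ k * (deriv ^^ n) f x)"
      using d by (intro continuous_intros continuous_at_imp_continuous_on)
        (auto intro: differentiable_imp_continuous_within)
    then have "bounded ((\<lambda>x. x ^ k * (deriv ^^ n) f x) ` {a..b})"
      by (intro compact_imp_bounded compact_continuous_image) auto
    then have "bounded (insert 0 ((\<lambda>x. x ^ k * (deriv ^^ n) f x) ` {a..b}))" by simp
    moreover have "x ^ k * (deriv ^^ n) f x \<in> insert 0 ((\<lambda>x. x ^ k * (deriv ^^ n) f x) ` {a..b})" for x
      by (cases "x \<in> {a..b}") (use z in auto)
    ultimately show ?thesis by (meson bounded_subset image_subsetI)
  qed
  with d show ?thesis by (simp add: schwartz_def)
qed

text \<open>A smooth function that is positive exactly on \<open>(a, b)\<close>. The parameter \<open>s\<close> plays the role of an exponent: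
  \<open>bump s\<close> is the \<open>s\<close>-th power of \<open>bump 1\<close>, which tends to the indicator of \<open>(a, b)\<close> as \<open>s\<close> tends to \<open>0\<close>.\<close>

definition bump :: "real \<Rightarrow> real \<Rightarrow> real \<Rightarrow> real \<Rightarrow> real" where
  "bump s a b t = flat 1 s (t - a) * flat 1 s (b - t)"

lemma bump_schwartz: "0 < s \<Longrightarrow> bump s a b \<in> schwartz"
proof (rule schwartzI_compact_support)
  assume s: "0 < s"
  show "times_differentiable n (bump s a b)" for n
    using times_differentiable_mult[OF times_differentiable_affine[OF times_differentiable_flat[OF s], of n 1 1 "- a"]
        times_differentiable_affine[OF times_differentiable_flat[OF s], of n 1 "-1" b]]
    by (simp add: bump_def[abs_def])
  show "bump s a b x = 0" if "x \<notin> {a..b}" for x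
    using that by (auto simp: bump_def flat_def)
qed

lemma bump_eq_0_iff: "bump s a b t = 0 \<longleftrightarrow> t \<notin> {a<..<b}"
  by (auto simp: bump_def flat_def)

lemma bump_nonneg: "0 \<le> bump s a b t"
  by (auto simp: bump_def flat_def)

lemma bump_le_1: "0 < s \<Longrightarrow> bump s a b t \<le> 1"
  by (auto simp: bump_def flat_def mult_le_one)

lemma bump_tendsto_indicator:
  "(\<lambda>n. bump (inverse (real (Suc n))) a b t) \<longlonglongrightarrow> indicator {a<..<b} t"
proof (cases "t \<in> {a<..<b}")
  case True
  have "(\<lambda>n. exp (- inverse (real (Suc n)) / (t - a)) * exp (- inverse (real (Suc n)) / (b - t)))
      \<longlonglongrightarrow> exp (- 0 / (t - a)) * exp (- 0 / (b - t))"
    using True by (intro tendsto_intros LIMSEQ_inverse_real_of_nat) auto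
  then show ?thesis using True by (simp add: bump_def flat_def)
qed (simp add: bump_eq_0_iff[THEN iffD2])

lemma schwartz_differentiable: "f \<in> schwartz \<Longrightarrow> (deriv ^^ n) f differentiable at x"
  by (simp add: schwartz_def)

lemma schwartz_deriv: "f \<in> schwartz \<Longrightarrow> deriv f \<in> schwartz"
proof -
  assume "f \<in> schwartz"
  moreover have "(deriv ^^ n) (deriv f) = (deriv ^^ Suc n) f" for n
    by (simp add: funpow_swap1)
  ultimately show ?thesis
    by (simp add: schwartz_def del: funpow.simps)
qed

lemma schwartz_DERIV: "f \<in> schwartz \<Longrightarrow> (f has_real_derivative deriv f x) (at x)"
  using schwartz_differentiable[of f 0 x] by (simp add: DERIV_deriv_iff_real_differentiable)

lemma schwartz_isCont: "f \<in> schwartz \<Longrightarrow> isCont f x"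
  using schwartz_DERIV DERIV_isCont by blast

lemma schwartz_borel [measurable_dest]: "f \<in> schwartz \<Longrightarrow> f \<in> borel_measurable borel"
  by (intro borel_measurable_continuous_onI continuous_at_imp_continuous_on) (auto intro: schwartz_isCont)

lemma schwartz_seminorm_upper:
  "f \<in> schwartz \<Longrightarrow> \<bar>x ^ k * (deriv ^^ n) f x\<bar> \<le> schwartz_seminorm k n f"
  unfolding schwartz_seminorm_def
proof (rule cSUP_upper)
  assume "f \<in> schwartz"
  then obtain B where "\<And>x. \<bar>x ^ k * (deriv ^^ n) f x\<bar> \<le> B"
    by (auto simp: schwartz_def bounded_iff) blast
  then show "bdd_above (range (\<lambda>x. \<bar>x ^ k * (deriv ^^ n) f x\<bar>))"
    by (auto intro!: bdd_aboveI)
qed simp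

lemma schwartz_bounded: "f \<in> schwartz \<Longrightarrow> bounded (range f)"
proof -
  assume "f \<in> schwartz"
  then have "bounded (range (\<lambda>x. x ^ 0 * (deriv ^^ 0) f x))"
    unfolding schwartz_def by blast
  then show ?thesis by simp
qed

lemma funpow_deriv_linear:
  assumes "f \<in> schwartz" "g \<in> schwartz"
  shows "(deriv ^^ n) (\<lambda>x. a * f x + b * g x) = (\<lambda>x. a * (deriv ^^ n) f x + b * (deriv ^^ n) g x)"
proof (induction n)
  case (Suc n)
  have "((\<lambda>x. a * (deriv ^^ n) f x + b * (deriv ^^ n) g x) has_real_derivative
      a * (deriv ^^ Suc n) f x + b * (deriv ^^ Suc n) g x) (at x)" for x
    using assms[THEN schwartz_differentiable, of n x]
    by (auto intro!: derivative_eq_intros simp: DERIV_deriv_iff_real_differentiable[symmetric])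
  then show ?case using Suc by (auto intro!: ext DERIV_imp_deriv)
qed simp

lemma schwartz_linear:
  assumes "f \<in> schwartz" "g \<in> schwartz"
  shows "(\<lambda>x. a * f x + b * g x) \<in> schwartz"
proof -
  have "bounded (range (\<lambda>x. x ^ k * (a * (deriv ^^ n) f x + b * (deriv ^^ n) g x)))" for k n
  proof -
    have "bounded ((\<lambda>x. a *\<^sub>R (x ^ k * (deriv ^^ n) f x) + b *\<^sub>R (x ^ k * (deriv ^^ n) g x)) ` UNIV)"
      using assms by (intro bounded_plus_comp bounded_scaleR_comp) (auto simp: schwartz_def)
    then show ?thesis by (simp add: algebra_simps)
  qed
  then show ?thesis
    using assms[THEN schwartz_differentiable] unfolding schwartz_def
    by (auto simp: funpow_deriv_linear[OF assms] intro!: derivative_intros)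
qed

lemma funpow_deriv_times_id:
  assumes "f \<in> schwartz"
  shows "(deriv ^^ n) (\<lambda>x. x * f x) = (\<lambda>x. x * (deriv ^^ n) f x + n * (deriv ^^ (n - 1)) f x)"
proof (induction n)
  case (Suc n)
  have D: "((deriv ^^ k) f has_real_derivative (deriv ^^ Suc k) f x) (at x)" for k x
    using assms[THEN schwartz_differentiable, of k x]
    by (auto simp: DERIV_deriv_iff_real_differentiable[symmetric])
  have "((\<lambda>x. x * (deriv ^^ n) f x + n * (deriv ^^ (n - 1)) f x) has_real_derivative
      x * (deriv ^^ Suc n) f x + Suc n * (deriv ^^ (Suc n - 1)) f x) (at x)" for x
  proof (cases n)
    case 0
    then show ?thesis using D[of 0 x] by (auto intro!: derivative_eq_intros)
  next
    case (Suc m)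
    show ?thesis
      unfolding Suc by (auto intro!: derivative_eq_intros D simp: algebra_simps simp del: funpow.simps)
  qed
  then show ?case using Suc by (auto intro!: ext DERIV_imp_deriv)
qed simp

lemma schwartz_times_id:
  assumes "f \<in> schwartz"
  shows "(\<lambda>x. x * f x) \<in> schwartz"
proof -
  have "bounded (range (\<lambda>x. x ^ k * (x * (deriv ^^ n) f x + n * (deriv ^^ (n - 1)) f x)))" for k n
  proof -
    have "bounded ((\<lambda>x. (x ^ Suc k * (deriv ^^ n) f x) + real n *\<^sub>R (x ^ k * (deriv ^^ (n - 1)) f x)) ` UNIV)"
      using assms unfolding schwartz_def by (intro bounded_plus_comp bounded_scaleR_comp) blast+
    then show ?thesis by (simp add: algebra_simps)
  qed
  then show ?thesis
    using assms[THEN schwartz_differentiable] unfolding schwartz_def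
    by (auto simp: funpow_deriv_times_id[OF assms] intro!: derivative_intros)
qed

section \<open>Integration against Schwartz functions\<close>

lemma integrable_inverse_1_plus_square: "integrable lborel (\<lambda>t::real. inverse (1 + t\<^sup>2))"
proof -
  have "set_integrable lborel (einterval (-\<infinity>) \<infinity>) (\<lambda>t::real. inverse (1 + t\<^sup>2))"
  proof (rule interval_integral_FTC_nonneg(1)[where F = arctan and A = "- (pi / 2)" and B = "pi / 2"])
    show "isCont (\<lambda>t::real. inverse (1 + t\<^sup>2)) x" for x
      by (intro continuous_intros) (auto simp: add_nonneg_eq_0_iff)
  qed (auto simp: ereal_tendsto_simps DERIV_arctan intro: tendsto_arctan_at_top tendsto_arctan_at_bot)
  then show ?thesis by (simp add: set_integrable_def)
qed

text \<open>A bound for \<open>(1 + \<bar>t\<bar>) (1 + t\<^sup>2) \<bar>f t\<bar>\<close>, obtained from \<open>2 (1 + t\<^sup>2)\<^sup>2 = 2 (1 + 2 t\<^sup>2 + t\<^sup>4)\<close>. One factor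
  \<open>1 + t\<^sup>2\<close> makes the integral over the line converge, the other one absorbs a linearly growing
  function.\<close>

definition decay_const :: "(real \<Rightarrow> real) \<Rightarrow> real" where
  "decay_const f = 2 * (schwartz_seminorm 0 0 f + 2 * schwartz_seminorm 2 0 f + schwartz_seminorm 4 0 f)"

lemma schwartz_decay:
  assumes "f \<in> schwartz"
  shows "(1 + \<bar>t\<bar>) * \<bar>f t\<bar> \<le> decay_const f * inverse (1 + t\<^sup>2)"
proof -
  have "0 \<le> (1 - \<bar>t\<bar>)\<^sup>2" by simp
  then have "2 * \<bar>t\<bar> \<le> 1 + t\<^sup>2" by (simp add: power2_diff)
  then have t: "1 + \<bar>t\<bar> \<le> 2 * (1 + t\<^sup>2)" using zero_le_power2[of t] by (smt (verit))
  have p: "0 < 1 + t\<^sup>2" by (simp add: add_pos_nonneg)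
  have "(1 + \<bar>t\<bar>) * \<bar>f t\<bar> * (1 + t\<^sup>2) \<le> (2 * (1 + t\<^sup>2)) * \<bar>f t\<bar> * (1 + t\<^sup>2)"
    using t p by (intro mult_right_mono) auto
  also have "\<dots> = 2 * (\<bar>t ^ 0 * (deriv ^^ 0) f t\<bar> + 2 * \<bar>t ^ 2 * (deriv ^^ 0) f t\<bar> + \<bar>t ^ 4 * (deriv ^^ 0) f t\<bar>)"
    by (simp add: abs_mult power_abs) algebra
  also have "\<dots> \<le> decay_const f"
    unfolding decay_const_def
    by (intro mult_left_mono add_mono schwartz_seminorm_upper[OF assms]) auto
  finally show ?thesis using p by (simp add: field_simps)
qed

text \<open>The growth of continuous functions with bounded second derivative measure, for which integrals
  against Schwartz functions converge.\<close>

definition linear_growth :: "(real \<Rightarrow> real) \<Rightarrow> bool" where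
  "linear_growth g \<longleftrightarrow> g \<in> borel_measurable borel \<and> (\<exists>C\<ge>0. \<forall>t. \<bar>g t\<bar> \<le> C * (1 + \<bar>t\<bar>))"

lemma integrable_linear_growth_schwartz:
  assumes g: "linear_growth g" and f: "f \<in> schwartz"
  shows "integrable lborel (\<lambda>t. g t * f t)"
proof -
  obtain C where C: "C \<ge> 0" "\<And>t. \<bar>g t\<bar> \<le> C * (1 + \<bar>t\<bar>)" and [measurable]: "g \<in> borel_measurable borel"
    using g by (auto simp: linear_growth_def)
  have [measurable]: "f \<in> borel_measurable borel" by (rule schwartz_borel[OF f])
  show ?thesis
  proof (rule Bochner_Integration.integrable_bound)
    show "integrable lborel (\<lambda>t. C * decay_const f * inverse (1 + t\<^sup>2))"
      using integrable_inverse_1_plus_square by simp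
    have "\<bar>g t * f t\<bar> \<le> \<bar>C * decay_const f * inverse (1 + t\<^sup>2)\<bar>" for t
    proof -
      have "\<bar>g t * f t\<bar> \<le> C * ((1 + \<bar>t\<bar>) * \<bar>f t\<bar>)"
        using mult_right_mono[OF C(2)[of t], of "\<bar>f t\<bar>"] by (simp add: abs_mult mult.assoc)
      also have "\<dots> \<le> C * (decay_const f * inverse (1 + t\<^sup>2))"
        using schwartz_decay[OF f] C by (intro mult_left_mono) auto
      finally show ?thesis by (simp add: mult.assoc)
    qed
    then show "AE t in lborel. norm (g t * f t) \<le> norm (C * decay_const f * inverse (1 + t\<^sup>2))" by simp
  qed simp
qed

lemma abs_integral_linear_growth_schwartz:
  assumes g: "linear_growth g"
  obtains K where "K \<ge> 0" "\<And>f. f \<in> schwartz \<Longrightarrow> \<bar>LINT t|lborel. g t * f t\<bar> \<le> K * decay_const f"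
proof -
  obtain C where C: "C \<ge> 0" "\<And>t. \<bar>g t\<bar> \<le> C * (1 + \<bar>t\<bar>)" and [measurable]: "g \<in> borel_measurable borel"
    using g by (auto simp: linear_growth_def)
  define I where "I = (LINT t|lborel. inverse (1 + t\<^sup>2 :: real))"
  show thesis
  proof (rule that[of "C * I"])
    show "0 \<le> C * I" using C by (auto simp: I_def add_nonneg_nonneg intro!: mult_nonneg_nonneg integral_nonneg_AE)
    fix f assume f: "f \<in> schwartz"
    have "\<bar>LINT t|lborel. g t * f t\<bar> \<le> (LINT t|lborel. \<bar>g t * f t\<bar>)" by (rule integral_abs_bound)
    also have "\<dots> \<le> (LINT t|lborel. C * decay_const f * inverse (1 + t\<^sup>2))"
    proof (rule integral_mono)
      show "integrable lborel (\<lambda>t. C * decay_const f * inverse (1 + t\<^sup>2))"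
        using integrable_inverse_1_plus_square by simp
      show "integrable lborel (\<lambda>t. \<bar>g t * f t\<bar>)"
        using integrable_linear_growth_schwartz[OF g f] by simp
      fix t :: real
      have "\<bar>g t * f t\<bar> \<le> C * ((1 + \<bar>t\<bar>) * \<bar>f t\<bar>)"
        using mult_right_mono[OF C(2)[of t], of "\<bar>f t\<bar>"] by (simp add: abs_mult mult.assoc)
      also have "\<dots> \<le> C * (decay_const f * inverse (1 + t\<^sup>2))"
        using schwartz_decay[OF f] C by (intro mult_left_mono) auto
      finally show "\<bar>g t * f t\<bar> \<le> C * decay_const f * inverse (1 + t\<^sup>2)" by (simp add: mult.assoc)
    qed
    also have "\<dots> = C * I * decay_const f" by (simp add: I_def)
    finally show "\<bar>LINT t|lborel. g t * f t\<bar> \<le> C * I * decay_const f" .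
  qed
qed

lemma linear_growth_const: "linear_growth (\<lambda>_. c)"
  unfolding linear_growth_def by (auto intro!: exI[of _ "\<bar>c\<bar>"] simp: algebra_simps)

lemma linear_growth_id: "linear_growth (\<lambda>t. t)"
  unfolding linear_growth_def by (auto intro!: exI[of _ 1])

lemma linear_growth_add:
  assumes "linear_growth g" "linear_growth h"
  shows "linear_growth (\<lambda>t. g t + h t)"
proof -
  obtain C D where "C \<ge> 0" "\<And>t. \<bar>g t\<bar> \<le> C * (1 + \<bar>t\<bar>)" "D \<ge> 0" "\<And>t. \<bar>h t\<bar> \<le> D * (1 + \<bar>t\<bar>)"
    using assms by (auto simp: linear_growth_def)
  then have "0 \<le> C + D" "\<bar>g t + h t\<bar> \<le> (C + D) * (1 + \<bar>t\<bar>)" for t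
    unfolding distrib_right using abs_triangle_ineq[of "g t" "h t"] by (auto intro: order_trans[OF _ add_mono])
  then show ?thesis using assms unfolding linear_growth_def by (auto intro!: exI[of _ "C + D"])
qed

lemma linear_growth_cmult:
  assumes "linear_growth g"
  shows "linear_growth (\<lambda>t. c * g t)"
proof -
  obtain C where C: "C \<ge> 0" "\<And>t. \<bar>g t\<bar> \<le> C * (1 + \<bar>t\<bar>)"
    using assms by (auto simp: linear_growth_def)
  then have "0 \<le> \<bar>c\<bar> * C" "\<bar>c * g t\<bar> \<le> \<bar>c\<bar> * C * (1 + \<bar>t\<bar>)" for t
    using mult_left_mono[OF C(2), of "\<bar>c\<bar>" t] by (auto simp: abs_mult mult.assoc)
  then show ?thesis using assms unfolding linear_growth_def by (auto intro!: exI[of _ "\<bar>c\<bar> * C"])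
qed

lemma integrable_schwartz: "f \<in> schwartz \<Longrightarrow> integrable lborel f"
  using integrable_linear_growth_schwartz[OF linear_growth_const[of 1], of f] by simp

lemma schwartz_tendsto_0:
  assumes "f \<in> schwartz"
  shows "(f \<longlongrightarrow> 0) at_top" "(f \<longlongrightarrow> 0) at_bot"
proof -
  have b: "norm (f t) \<le> decay_const f * inverse (1 + t\<^sup>2)" for t
    using schwartz_decay[OF assms, of t] mult_right_mono[of 1 "1 + \<bar>t\<bar>" "\<bar>f t\<bar>"] by simp
  have "((\<lambda>t. inverse (1 + t\<^sup>2)) \<longlongrightarrow> 0) F" if "filterlim (\<lambda>t. t\<^sup>2) at_top F" for F :: "real filter"
    by (rule tendsto_inverse_0_at_top)
      (auto intro!: filterlim_tendsto_add_at_top that tendsto_const)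
  note * = tendsto_mult_right_zero[OF this, of _ "decay_const f"]
  have "filterlim (\<lambda>t::real. t\<^sup>2) at_top at_top" "filterlim (\<lambda>t::real. t\<^sup>2) at_top at_bot"
    by (auto intro!: filterlim_pow_at_top filterlim_pow_at_bot_even[OF _ filterlim_ident] filterlim_ident)
  from *[OF this(1)] *[OF this(2)]
  show "(f \<longlongrightarrow> 0) at_top" "(f \<longlongrightarrow> 0) at_bot"
    by (auto intro!: Lim_null_comparison[OF always_eventually[OF allI[OF b]]])
qed

lemma integral_schwartz_deriv:
  assumes "f \<in> schwartz"
  shows "(LINT t|lborel. deriv f t) = 0"
proof -
  have "(LBINT t=-\<infinity>..\<infinity>. deriv f t) = 0 - 0"
  proof (rule interval_integral_FTC_integrable[where F = f])
    show "set_integrable lborel (einterval (-\<infinity>) \<infinity>) (deriv f)"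
      using integrable_schwartz[OF schwartz_deriv[OF assms]] by (simp add: set_integrable_def)
  qed (use assms schwartz_tendsto_0[OF assms] in \<open>auto simp: ereal_tendsto_simps schwartz_isCont schwartz_deriv
      has_real_derivative_iff_has_vector_derivative[symmetric] schwartz_DERIV\<close>)
  then show ?thesis
    by (simp add: interval_lebesgue_integral_def set_lebesgue_integral_def)
qed

text \<open>The ramp is a fundamental solution of \<open>D\<^sup>2\<close>: on \<open>(s, \<infinity>)\<close> the integrand has the primitive
  \<open>(t - s) f'(t) - f(t)\<close>, which vanishes at infinity and equals \<open>- f(s)\<close> at \<open>s\<close>.\<close>

lemma integral_ramp_schwartz:
  assumes f: "f \<in> schwartz"
  shows "(LINT t|lborel. max 0 (t - s) * deriv (deriv f) t) = f s"
proof -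
  define F where "F t = (t - s) * deriv f t - f t" for t
  have f1: "deriv f \<in> schwartz" and f2: "deriv (deriv f) \<in> schwartz"
    using f by (auto intro: schwartz_deriv)
  have F0: "(F \<longlongrightarrow> 0) at_top"
    using schwartz_tendsto_0(1)[OF schwartz_times_id[OF f1]] schwartz_tendsto_0(1)[OF f1] schwartz_tendsto_0(1)[OF f]
    unfolding F_def left_diff_distrib
    by (intro tendsto_eq_rhs[OF tendsto_diff[OF tendsto_diff[OF _ tendsto_mult_right_zero]]]) auto
  have DF: "(F has_real_derivative (t - s) * deriv (deriv f) t) (at t)" for t
    unfolding F_def by (auto intro!: derivative_eq_intros schwartz_DERIV f f1)
  have "isCont F s" using DF DERIV_isCont by blast
  then have Fs: "(F \<longlongrightarrow> - f s) (at_right s)"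
    by (simp add: isCont_def F_def filterlim_at_split)
  have "linear_growth (\<lambda>t. indicator {s<..} t * (t - s))"
    unfolding linear_growth_def
    by (auto intro!: exI[of _ "1 + \<bar>s\<bar>"] simp: indicator_def algebra_simps) (smt (verit) abs_ge_zero mult_nonneg_nonneg)
  from integrable_linear_growth_schwartz[OF this f2]
  have "(LBINT t=ereal s..\<infinity>. (t - s) * deriv (deriv f) t) = 0 - (- f s)"
    by (intro interval_integral_FTC_integrable[where F = F])
      (use F0 Fs in \<open>auto simp: ereal_tendsto_simps set_integrable_def mult.assoc
      has_real_derivative_iff_has_vector_derivative[symmetric] DF intro!: isCont_mult isCont_diff schwartz_isCont[OF f2]\<close>)
  moreover have "(LBINT t=ereal s..\<infinity>. (t - s) * deriv (deriv f) t) = (LINT t|lborel. max 0 (t - s) * deriv (deriv f) t)"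
    by (auto simp: interval_lebesgue_integral_def set_lebesgue_integral_def indicator_def max_def intro!: Bochner_Integration.integral_cong)
  ultimately show ?thesis by simp
qed

text \<open>A Schwartz function of mean zero has a Schwartz primitive: the integrals over the two half-lines
  ending at \<open>t\<close> agree up to sign, so that either of them can be used to see the decay.\<close>

lemma schwartz_primitive:
  assumes f: "f \<in> schwartz" and mean: "(LINT t|lborel. f t) = 0"
  obtains F where "F \<in> schwartz" "deriv F = f"
proof -
  define F where "F t = (LINT u|lborel. indicator {..t} u * f u)" for t
  have intf: "integrable lborel f" by (rule integrable_schwartz[OF f])
  have inti: "integrable lborel (\<lambda>u. indicator A u * f u)" if "A \<in> sets borel" for A
    using integrable_real_mult_indicator[OF _ intf, of A] that by (simp add: mult.commute)
  obtain G where G: "\<And>t. (G has_real_derivative f t) (at t)"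
    unfolding has_real_derivative_iff_has_vector_derivative
    using einterval_antiderivative[of "-\<infinity>" "\<infinity>" f] schwartz_isCont[OF f] by auto
  have FG: "F t - F u = G t - G u" if "u \<le> t" for t u
  proof -
    have "F t - F u = (LINT v|lborel. indicator {..t} v * f v - indicator {..u} v * f v)"
      by (simp add: F_def inti)
    also have "\<dots> = (LINT v|lborel. indicator {u<..t} v * f v)"
      using that by (intro Bochner_Integration.integral_cong) (auto simp: indicator_def)
    also have "\<dots> = (LBINT v=u..t. f v)"
      using that by (auto simp: interval_integral_Ioc set_lebesgue_integral_def)
    also have "\<dots> = G t - G u"
    proof (rule interval_integral_FTC_finite)
      show "continuous_on {min u t..max u t} f"
        using schwartz_isCont[OF f] by (simp add: continuous_at_imp_continuous_on)
      show "(G has_vector_derivative f v) (at v within {min u t..max u t})" for v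
        using G[of v] unfolding has_real_derivative_iff_has_vector_derivative
        by (rule has_vector_derivative_at_within)
    qed
    finally show ?thesis .
  qed
  have "F t = G t + (F 0 - G 0)" for t
    using FG[of t 0] FG[of 0 t] by (cases "0 \<le> t") auto
  then have FGeq: "F = (\<lambda>t. G t + (F 0 - G 0))" by (rule ext)
  have DF: "(F has_real_derivative f t) (at t)" for t
    by (subst FGeq) (auto intro!: derivative_eq_intros G)
  have dF: "deriv F = f" using DF by (auto intro!: ext DERIV_imp_deriv)
  \<comment> \<open>The weight \<open>t ^ k\<close> may be moved under the integral as \<open>u ^ k\<close>, since the half-line is chosen to point
    away from the origin.\<close>
  have bound: "\<bar>t ^ k * F t\<bar> \<le> (LINT u|lborel. \<bar>u ^ k * f u\<bar>)" for t k
  proof -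
    have "(\<lambda>u. u ^ k * f u) \<in> schwartz"
    proof (induction k)
      case (Suc k)
      from schwartz_times_id[OF this] show ?case by (simp add: mult.assoc)
    qed (use f in simp)
    then have intk: "integrable lborel (\<lambda>u. u ^ k * f u)" by (rule integrable_schwartz)
    have half: "\<bar>t ^ k * (LINT u|lborel. indicator A u * f u)\<bar> \<le> (LINT u|lborel. \<bar>u ^ k * f u\<bar>)"
      if A: "A \<in> sets borel" "\<And>u. u \<in> A \<Longrightarrow> \<bar>t\<bar> \<le> \<bar>u\<bar>" for A
    proof -
      have "\<bar>t ^ k * (LINT u|lborel. indicator A u * f u)\<bar> = \<bar>LINT u|lborel. t ^ k * (indicator A u * f u)\<bar>"
        by simp
      also have "\<dots> \<le> (LINT u|lborel. \<bar>t ^ k * (indicator A u * f u)\<bar>)"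
        by (rule integral_abs_bound)
      also have "\<dots> \<le> (LINT u|lborel. \<bar>u ^ k * f u\<bar>)"
      proof (rule integral_mono)
        show "integrable lborel (\<lambda>u. \<bar>t ^ k * (indicator A u * f u)\<bar>)"
          by (intro integrable_abs integrable_mult_right inti A)
        show "integrable lborel (\<lambda>u. \<bar>u ^ k * f u\<bar>)" using intk by (rule integrable_abs)
      qed (use A(2) in \<open>auto simp: abs_mult indicator_def power_abs intro!: mult_right_mono power_mono\<close>)
      finally show ?thesis .
    qed
    show ?thesis
    proof (cases "t \<le> 0")
      case True
      then show ?thesis unfolding F_def by (intro half) auto
    next
      case False
      have "F t + (LINT u|lborel. indicator {t<..} u * f u)
          = (LINT u|lborel. indicator {..t} u * f u + indicator {t<..} u * f u)"
        by (simp add: F_def inti)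
      also have "\<dots> = (LINT u|lborel. f u)"
        by (intro Bochner_Integration.integral_cong) (auto simp: indicator_def)
      finally have "F t + (LINT u|lborel. indicator {t<..} u * f u) = (LINT u|lborel. f u)" .
      then have "F t = - (LINT u|lborel. indicator {t<..} u * f u)" using mean by simp
      then show ?thesis using half[of "{t<..}"] False by simp
    qed
  qed
  have "F \<in> schwartz"
    unfolding schwartz_def
  proof (intro CollectI conjI allI)
    fix n k and x :: real
    have derivs: "(deriv ^^ Suc m) F = (deriv ^^ m) f" for m
      using dF by (simp add: funpow_swap1)
    show "(deriv ^^ n) F differentiable at x"
    proof (cases n)
      case 0
      then show ?thesis using DF by (auto simp: real_differentiable_def)
    next
      case (Suc m)
      then show ?thesis using schwartz_differentiable[OF f] derivs by (simp del: funpow.simps)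
    qed
    show "bounded (range (\<lambda>x. x ^ k * (deriv ^^ n) F x))"
    proof (cases n)
      case 0
      then show ?thesis using bound[of _ k] by (auto simp: bounded_iff)
    next
      case (Suc m)
      then show ?thesis using f derivs by (simp add: schwartz_def del: funpow.simps)
    qed
  qed
  with dF show thesis by (rule that[rotated])
qed

text \<open>Integration by parts turns the vanishing first moment of \<open>f\<close> into the vanishing mean of its
  primitive.\<close>

lemma schwartz_second_primitive:
  assumes f: "f \<in> schwartz" and mean: "(LINT t|lborel. f t) = 0" and moment: "(LINT t|lborel. t * f t) = 0"
  obtains F where "F \<in> schwartz" "deriv (deriv F) = f"
proof -
  obtain G where G: "G \<in> schwartz" "deriv G = f" using schwartz_primitive[OF f mean] .
  have "(LINT t|lborel. deriv (\<lambda>t. t * G t) t) = 0"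
    by (rule integral_schwartz_deriv[OF schwartz_times_id[OF G(1)]])
  moreover have "deriv (\<lambda>t. t * G t) = (\<lambda>t. G t + t * f t)"
    using funpow_deriv_times_id[OF G(1), of 1] G(2) by (auto simp: fun_eq_iff)
  moreover have "integrable lborel (\<lambda>t. t * f t)"
    by (rule integrable_linear_growth_schwartz[OF linear_growth_id f])
  ultimately have "(LINT t|lborel. G t) = 0"
    using moment integrable_schwartz[OF G(1)] by simp
  then obtain F where "F \<in> schwartz" "deriv F = G" using schwartz_primitive[OF G(1)] by blast
  then show thesis using G by (intro that[of F]) auto
qed

section \<open>Uniqueness of the measure and of the continuous representative\<close>

lemma signed_integral_tendsto:
  assumes \<mu>: "\<mu> \<in> bounded_radon_measure"
    and m: "\<And>n. \<phi> n \<in> borel_measurable borel" "\<psi> \<in> borel_measurable borel"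
    and b: "\<And>n t. \<bar>\<phi> n t\<bar> \<le> C" and lim: "\<And>t. (\<lambda>n. \<phi> n t) \<longlonglongrightarrow> \<psi> t"
  shows "(\<lambda>n. signed_integral \<mu> (\<phi> n)) \<longlonglongrightarrow> signed_integral \<mu> \<psi>"
proof -
  obtain \<nu> \<sigma> where "polar_form \<nu> \<mu> \<sigma>" using polar_decomposition[OF \<mu>] .
  then interpret polar_form \<nu> \<mu> \<sigma> .
  note m[measurable]
  have b': "\<bar>\<psi> t\<bar> \<le> C" for t
    using tendsto_rabs[OF lim[of t]] b by (intro LIMSEQ_le_const2) auto
  have "(\<lambda>n. LINT t|\<nu>. \<sigma> t * \<phi> n t) \<longlonglongrightarrow> (LINT t|\<nu>. \<sigma> t * \<psi> t)"
  proof (rule integral_dominated_convergence[where w = "\<lambda>_. C"])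
    show "integrable \<nu> (\<lambda>_. C)" by simp
    show "AE t in \<nu>. (\<lambda>n. \<sigma> t * \<phi> n t) \<longlonglongrightarrow> \<sigma> t * \<psi> t"
      by (intro AE_I2 tendsto_intros lim)
  qed (use b abs_sign in \<open>auto simp: abs_mult\<close>)
  then show ?thesis
    using b b' by (subst (1 2) signed_integral_eq) (auto intro!: m boundedI[of _ C])
qed

lemma signed_integral_indicator:
  assumes "\<mu> \<in> bounded_radon_measure" "A \<in> sets borel"
  shows "signed_integral \<mu> (indicator A) = \<mu> A"
proof -
  obtain \<nu> \<sigma> where "polar_form \<nu> \<mu> \<sigma>" using polar_decomposition[OF assms(1)] .
  then interpret polar_form \<nu> \<mu> \<sigma> .
  have "bounded (range (indicator A :: real \<Rightarrow> real))"
    by (rule boundedI[of _ 1]) (auto simp: indicator_def)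
  then show ?thesis
    using assms(2) by (simp add: signed_integral_eq measure_eq)
qed

lemma bounded_radon_measure_additive:
  assumes "\<mu> \<in> bounded_radon_measure"
  shows "countably_additive_on borel \<mu>"
  using assms by (auto simp: countably_additive_on_def bounded_radon_measure_def)

text \<open>The bumps \<open>bump s a b\<close> tend boundedly to the indicator of \<open>(a, b)\<close> as \<open>s\<close> tends to \<open>0\<close>, so the
  distribution determines the measure on open intervals, which form an intersection-stable generator
  of the Borel sets. The measure of the whole line, needed for complements, is the limit of the
  measures of \<open>(- n, n)\<close>.\<close>

lemma measure_distr_inject:
  assumes \<mu>: "\<mu> \<in> bounded_radon_measure" "\<mu>' \<in> bounded_radon_measure"
    and eq: "measure_distr \<mu> = measure_distr \<mu>'"
  shows "\<mu> = \<mu>'"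
proof -
  have eqS: "signed_integral \<mu> \<phi> = signed_integral \<mu>' \<phi>" if "\<phi> \<in> schwartz" for \<phi>
    using fun_cong[OF eq, of \<phi>] that by (simp add: measure_distr_def)
  have ival: "\<mu> {a<..<b} = \<mu>' {a<..<b}" for a b
  proof -
    have "(\<lambda>n. signed_integral \<nu> (bump (inverse (real (Suc n))) a b)) \<longlonglongrightarrow> \<nu> {a<..<b}"
      if "\<nu> \<in> bounded_radon_measure" for \<nu>
    proof -
      have "(\<lambda>n. signed_integral \<nu> (bump (inverse (real (Suc n))) a b)) \<longlonglongrightarrow> signed_integral \<nu> (indicator {a<..<b})"
        by (rule signed_integral_tendsto[OF that, where C = 1])
          (simp_all add: bump_tendsto_indicator abs_of_nonneg[OF bump_nonneg] bump_le_1 bump_schwartz schwartz_borel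
            del: of_nat_Suc)
      then show ?thesis using that by (simp add: signed_integral_indicator)
    qed
    from this[OF \<mu>(1)] this[OF \<mu>(2)] show ?thesis
      by (simp add: eqS bump_schwartz LIMSEQ_unique)
  qed
  have univ: "\<mu> UNIV = \<mu>' UNIV"
  proof -
    have "(\<lambda>n. \<nu> {- real n<..<real n}) \<longlonglongrightarrow> \<nu> UNIV" if "\<nu> \<in> bounded_radon_measure" for \<nu>
    proof -
      have "(\<lambda>n. signed_integral \<nu> (indicator {- real n<..<real n})) \<longlonglongrightarrow> signed_integral \<nu> (indicator UNIV)"
      proof (rule signed_integral_tendsto[OF that, where C = 1])
        fix t :: real
        obtain N where N: "\<bar>t\<bar> < real N" using reals_Archimedean2 by blast
        have "\<forall>\<^sub>F n in sequentially. 1 = (indicator {- real n<..<real n} t :: real)"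
          using eventually_ge_at_top[of N] by eventually_elim (use N in \<open>auto simp: indicator_def\<close>)
        then show "(\<lambda>n. indicator {- real n<..<real n} t :: real) \<longlonglongrightarrow> indicator UNIV t"
          by (simp add: Lim_transform_eventually[OF tendsto_const])
      qed (auto simp: indicator_def[abs_def])
      then show ?thesis using that by (simp add: signed_integral_indicator del: indicator_UNIV)
    qed
    from this[OF \<mu>(1)] this[OF \<mu>(2)] show ?thesis by (simp add: ival LIMSEQ_unique)
  qed
  have sets: "sets borel = sigma_sets UNIV (range (\<lambda>(a, b). {a<..<b::real}))"
    by (subst borel_eq_box) (simp add: box_real[abs_def])
  have stable: "Int_stable (range (\<lambda>(a, b). {a<..<b::real}))"
    by (auto simp: Int_stable_def image_iff intro!: exI)
  have pow: "range (\<lambda>(a, b). {a<..<b::real}) \<subseteq> Pow UNIV"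
    by simp
  have "\<mu> A = \<mu>' A" if "A \<in> sigma_sets UNIV (range (\<lambda>(a, b). {a<..<b}))" for A
    using stable pow that
  proof (induction A rule: sigma_sets_induct_disjoint)
    case (compl A)
    then have "A \<in> sets borel" by (simp add: sets)
    then show ?case
      using compl univ \<mu>[THEN bounded_radon_measure_additive, THEN signed_Diff, of UNIV A] by simp
  next
    case (union A)
    then have "range A \<subseteq> sets borel" by (simp add: sets)
    from \<mu>[THEN bounded_radon_measure_additive, THEN signed_sums, OF this union(1)] union(3)
    show ?case by (simp add: sums_unique2)
  qed (use ival \<mu>[THEN bounded_radon_measure_additive, THEN signed_empty] in auto)
  then show ?thesis
    using \<mu> sets by (intro extensionalityI[of _ "sets borel"]) (auto simp: bounded_radon_measure_def)
qed

lemma norm_M_measure_distr: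
  assumes "\<mu> \<in> bounded_radon_measure"
  shows "norm_M (measure_distr \<mu>) = total_variation \<mu>"
proof -
  have "(THE \<mu>'. \<mu>' \<in> bounded_radon_measure \<and> measure_distr \<mu>' = measure_distr \<mu>) = \<mu>"
    using assms measure_distr_inject by (intro the_equality) auto
  then show ?thesis by (simp add: norm_M_def)
qed

text \<open>If two continuous representatives differed somewhere, a bump supported where their difference
  has a sign would tell them apart.\<close>

lemma represented_by_le:
  assumes T: "represented_by T g" "represented_by T h"
    and cont: "continuous_on UNIV g" "continuous_on UNIV h"
  shows "g x \<le> h x"
proof (rule ccontr)
  assume "\<not> g x \<le> h x"
  moreover have "open {t. h t < g t}"
    using cont by (intro open_Collect_less)
  ultimately obtain e where e: "e > 0" "ball x e \<subseteq> {t. h t < g t}"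
    unfolding open_contains_ball by (metis (mono_tags) mem_Collect_eq not_le)
  define \<phi> where "\<phi> = bump 1 (x - e) (x + e)"
  have \<phi>: "\<phi> \<in> schwartz" by (simp add: \<phi>_def bump_schwartz)
  have pos: "h t < g t" if "t \<in> {x - e<..<x + e}" for t
    using e(2) that by (auto simp: ball_def dist_real_def subset_iff abs_less_iff)
  have int: "integrable lborel (\<lambda>t. (g t - h t) * \<phi> t)" "(LINT t|lborel. (g t - h t) * \<phi> t) = 0"
    using T \<phi> by (auto simp: represented_by_def left_diff_distrib)
  have nonneg: "0 \<le> (g t - h t) * \<phi> t" for t
    using pos[of t] bump_eq_0_iff[of 1 "x - e" "x + e" t] bump_nonneg[of 1 "x - e" "x + e" t]
    by (cases "t \<in> {x - e<..<x + e}") (auto simp: \<phi>_def)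
  have "AE t in lborel. (g t - h t) * \<phi> t = 0"
    using integral_nonneg_eq_0_iff_AE[OF int(1)] int(2) nonneg by simp
  then have "AE t in lborel. t \<notin> {x - e<..<x + e}"
  proof eventually_elim
    case (elim t)
    then show ?case using pos[of t] bump_eq_0_iff[of 1 "x - e" "x + e" t] by (auto simp: \<phi>_def)
  qed
  then have "emeasure lborel {x - e<..<x + e} = 0"
    by (subst (asm) AE_iff_measurable[where N = "{x - e<..<x + e}"]) auto
  then show False using e(1) by (simp add: ennreal_eq_0_iff)
qed

lemma point_value_eq:
  assumes "continuous_on UNIV g" "represented_by T g"
  shows "point_value T = g"
  unfolding point_value_def
proof (rule the_equality)
  show "h = g" if "continuous_on UNIV h \<and> represented_by T h" for h
    using that assms represented_by_le[of T] by (intro ext antisym) blast+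
qed (use assms in simp)

section \<open>Second primitives of measures\<close>

definition ramp_kernel :: "real \<Rightarrow> real \<Rightarrow> real" where
  "ramp_kernel t s = max 0 (t - s) - max 0 (- s)"

lemma ramp_kernel_borel [measurable]:
  "(\<lambda>p. ramp_kernel (fst p) (snd p)) \<in> borel_measurable (borel \<Otimes>\<^sub>M borel)"
  "ramp_kernel t \<in> borel_measurable borel" "(\<lambda>t. ramp_kernel t s) \<in> borel_measurable borel"
  unfolding ramp_kernel_def[abs_def] by measurable

lemma ramp_kernel_Lipschitz: "\<bar>ramp_kernel t s - ramp_kernel u s\<bar> \<le> \<bar>t - u\<bar>"
  by (auto simp: ramp_kernel_def max_def)

lemma ramp_kernel_bound: "\<bar>ramp_kernel t s\<bar> \<le> \<bar>t\<bar>"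
  using ramp_kernel_Lipschitz[of t s 0] by (simp add: ramp_kernel_def)

lemma bounded_ramp_kernel: "bounded (range (ramp_kernel t))"
  using ramp_kernel_bound[of t] by (auto intro!: boundedI)

text \<open>Subtracting the value of the ramp at \<open>0\<close> keeps the kernel bounded in \<open>s\<close>, so that it can be
  integrated against an arbitrary bounded measure.\<close>

definition ramp_potential :: "(real set \<Rightarrow> real) \<Rightarrow> real \<Rightarrow> real" where
  "ramp_potential \<mu> t = signed_integral \<mu> (ramp_kernel t)"

lemma ramp_potential_Lipschitz:
  assumes \<mu>: "\<mu> \<in> bounded_radon_measure"
  shows "\<bar>ramp_potential \<mu> t - ramp_potential \<mu> u\<bar> \<le> total_variation \<mu> * \<bar>t - u\<bar>"
proof -
  obtain \<nu> \<sigma> where "polar_form \<nu> \<mu> \<sigma>" using polar_decomposition[OF \<mu>] .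
  then interpret polar_form \<nu> \<mu> \<sigma> .
  have int: "integrable \<nu> (\<lambda>s. \<sigma> s * ramp_kernel t s)" for t
    by (rule integrable_const_bound[of _ "\<bar>t\<bar>"]) (auto simp: abs_mult abs_sign ramp_kernel_bound)
  have "ramp_potential \<mu> t - ramp_potential \<mu> u = (LINT s|\<nu>. \<sigma> s * ramp_kernel t s - \<sigma> s * ramp_kernel u s)"
    by (simp add: ramp_potential_def signed_integral_eq bounded_ramp_kernel ramp_kernel_borel int)
  also have "\<bar>\<dots>\<bar> \<le> (LINT s|\<nu>. \<bar>\<sigma> s * ramp_kernel t s - \<sigma> s * ramp_kernel u s\<bar>)"
    by (rule integral_abs_bound)
  also have "\<dots> \<le> (LINT s|\<nu>. \<bar>t - u\<bar>)"
    by (intro integral_mono integrable_abs Bochner_Integration.integrable_diff int)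
      (auto simp: right_diff_distrib[symmetric] abs_mult abs_sign ramp_kernel_Lipschitz)
  finally show ?thesis by (simp add: total_variation_eq)
qed

lemma total_variation_nonneg: "\<mu> \<in> bounded_radon_measure \<Longrightarrow> 0 \<le> total_variation \<mu>"
  by (metis polar_decomposition polar_form.total_variation_eq measure_nonneg)

lemma continuous_ramp_potential:
  assumes \<mu>: "\<mu> \<in> bounded_radon_measure"
  shows "continuous_on UNIV (ramp_potential \<mu>)"
proof -
  have "(total_variation \<mu>)-lipschitz_on UNIV (ramp_potential \<mu>)"
    using ramp_potential_Lipschitz[OF \<mu>] total_variation_nonneg[OF \<mu>]
    by (auto intro!: lipschitz_onI simp: dist_real_def)
  then show ?thesis by (rule lipschitz_on_continuous_on)
qed

lemma linear_growth_ramp_potential: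
  assumes \<mu>: "\<mu> \<in> bounded_radon_measure"
  shows "linear_growth (ramp_potential \<mu>)"
proof -
  obtain \<nu> \<sigma> where "polar_form \<nu> \<mu> \<sigma>" using polar_decomposition[OF \<mu>] .
  then interpret polar_form \<nu> \<mu> \<sigma> .
  have "ramp_potential \<mu> 0 = 0"
    using signed_integral_eq[of "ramp_kernel 0"] by (simp add: ramp_potential_def ramp_kernel_def[abs_def])
  then have "\<bar>ramp_potential \<mu> t\<bar> \<le> total_variation \<mu> * (1 + \<bar>t\<bar>)" for t
    using ramp_potential_Lipschitz[OF \<mu>, of t 0] total_variation_nonneg[OF \<mu>] by (simp add: distrib_left)
  then show ?thesis
    unfolding linear_growth_def
    using total_variation_nonneg[OF \<mu>] borel_measurable_continuous_onI[OF continuous_ramp_potential[OF \<mu>]] by blast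
qed

text \<open>Fubini and the fact that the ramp is a fundamental solution of \<open>D\<^sup>2\<close>. The integrand is dominated by
  \<open>\<bar>t f''(t)\<bar>\<close>, independently of \<open>s\<close>, because of the normalisation of the kernel.\<close>

lemma integral_ramp_potential_deriv2:
  assumes \<mu>: "\<mu> \<in> bounded_radon_measure" and f: "f \<in> schwartz"
  shows "(LINT t|lborel. ramp_potential \<mu> t * deriv (deriv f) t) = signed_integral \<mu> f"
proof -
  obtain \<nu> \<sigma> where "polar_form \<nu> \<mu> \<sigma>" using polar_decomposition[OF \<mu>] .
  then interpret \<nu>: polar_form \<nu> \<mu> \<sigma> .
  interpret pair_sigma_finite \<nu> lborel by unfold_locales
  have f2: "deriv (deriv f) \<in> schwartz" by (intro schwartz_deriv f)
  have [measurable]: "deriv (deriv f) \<in> borel_measurable borel" by (rule schwartz_borel[OF f2])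
  have lgk: "linear_growth (\<lambda>t. ramp_kernel t s)" for s
    unfolding linear_growth_def
    by (auto intro!: exI[of _ 1] intro: order_trans[OF ramp_kernel_bound])
  have intt: "integrable lborel (\<lambda>t. ramp_kernel t s * deriv (deriv f) t)" for s
    by (rule integrable_linear_growth_schwartz[OF lgk f2])
  have int1: "integrable lborel (\<lambda>t. \<bar>t * deriv (deriv f) t\<bar>)"
    using integrable_linear_growth_schwartz[OF linear_growth_id f2] by simp
  have joint: "integrable (\<nu> \<Otimes>\<^sub>M lborel) (\<lambda>(s, t). \<sigma> s * (ramp_kernel t s * deriv (deriv f) t))"
  proof (rule Fubini_integrable)
    show "(\<lambda>(s, t). \<sigma> s * (ramp_kernel t s * deriv (deriv f) t)) \<in> borel_measurable (\<nu> \<Otimes>\<^sub>M lborel)"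
      unfolding ramp_kernel_def by measurable
    show "AE s in \<nu>. integrable lborel (\<lambda>t. case (s, t) of (s, t) \<Rightarrow> \<sigma> s * (ramp_kernel t s * deriv (deriv f) t))"
      using intt by simp
    have "(LINT t|lborel. \<bar>\<sigma> s * (ramp_kernel t s * deriv (deriv f) t)\<bar>) \<le> (LINT t|lborel. \<bar>t * deriv (deriv f) t\<bar>)" for s
    proof (rule integral_mono)
      show "integrable lborel (\<lambda>t. \<bar>\<sigma> s * (ramp_kernel t s * deriv (deriv f) t)\<bar>)"
        by (intro integrable_abs integrable_mult_right intt)
    qed (use int1 in \<open>auto simp: abs_mult \<nu>.abs_sign intro!: mult_right_mono ramp_kernel_bound\<close>)
    moreover have "(\<lambda>s. LINT t|lborel. \<bar>\<sigma> s * (ramp_kernel t s * deriv (deriv f) t)\<bar>) \<in> borel_measurable \<nu>"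
      unfolding ramp_kernel_def by measurable
    ultimately show "integrable \<nu> (\<lambda>s. LINT t|lborel. norm (case (s, t) of (s, t) \<Rightarrow> \<sigma> s * (ramp_kernel t s * deriv (deriv f) t)))"
      by (intro \<nu>.integrable_const_bound[of _ "LINT t|lborel. \<bar>t * deriv (deriv f) t\<bar>"]) auto
  qed
  have inner: "(LINT t|lborel. ramp_kernel t s * deriv (deriv f) t) = f s" for s
  proof -
    have lg: "linear_growth (\<lambda>t. max 0 (t - s))"
      unfolding linear_growth_def
      by (auto intro!: exI[of _ "1 + \<bar>s\<bar>"] simp: max_def algebra_simps) (smt (verit) abs_ge_zero mult_nonneg_nonneg)
    have "(LINT t|lborel. ramp_kernel t s * deriv (deriv f) t)
        = (LINT t|lborel. max 0 (t - s) * deriv (deriv f) t) - max 0 (- s) * (LINT t|lborel. deriv (deriv f) t)"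
      using integrable_linear_growth_schwartz[OF lg f2] integrable_schwartz[OF f2]
      by (simp add: ramp_kernel_def left_diff_distrib)
    then show ?thesis
      using integral_ramp_schwartz[OF f] integral_schwartz_deriv[OF schwartz_deriv[OF f]] by simp
  qed
  have "(LINT t|lborel. ramp_potential \<mu> t * deriv (deriv f) t)
      = (LINT t|lborel. LINT s|\<nu>. \<sigma> s * (ramp_kernel t s * deriv (deriv f) t))"
    by (simp add: ramp_potential_def \<nu>.signed_integral_eq bounded_ramp_kernel ramp_kernel_borel mult.assoc[symmetric])
  also have "\<dots> = (LINT s|\<nu>. LINT t|lborel. \<sigma> s * (ramp_kernel t s * deriv (deriv f) t))"
    by (rule Fubini_integral[OF joint])
  also have "\<dots> = signed_integral \<mu> f"
    by (simp add: inner \<nu>.signed_integral_eq schwartz_borel[OF f] schwartz_bounded[OF f])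
  finally show ?thesis .
qed

definition function_distr :: "(real \<Rightarrow> real) \<Rightarrow> (real \<Rightarrow> real) \<Rightarrow> real" where
  "function_distr g = (\<lambda>\<phi>\<in>schwartz. LINT t|lborel. g t * \<phi> t)"

lemma represented_by_function_distr:
  "linear_growth g \<Longrightarrow> represented_by (function_distr g) g"
  by (simp add: represented_by_def function_distr_def integrable_linear_growth_schwartz)

lemma function_distr_tempered:
  assumes g: "linear_growth g"
  shows "function_distr g \<in> tempered_distribution"
proof -
  obtain K where K: "K \<ge> 0" "\<And>f. f \<in> schwartz \<Longrightarrow> \<bar>LINT t|lborel. g t * f t\<bar> \<le> K * decay_const f"
    using abs_integral_linear_growth_schwartz[OF g] by blast
  have "\<bar>function_distr g \<phi>\<bar> \<le> (4 * K) * (\<Sum>k\<le>4. \<Sum>n\<le>4. schwartz_seminorm k n \<phi>)" if \<phi>: "\<phi> \<in> schwartz" for \<phi>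
  proof -
    have nn: "0 \<le> schwartz_seminorm k n \<phi>" for k n
      using schwartz_seminorm_upper[OF \<phi>, of 0 k n] abs_ge_zero order_trans by blast
    have "schwartz_seminorm k 0 \<phi> \<le> (\<Sum>n\<le>4. schwartz_seminorm k n \<phi>)" for k
      using nn by (intro member_le_sum) auto
    then have "(\<Sum>k\<in>{0, 2, 4}. schwartz_seminorm k 0 \<phi>) \<le> (\<Sum>k\<in>{0, 2, 4}. \<Sum>n\<le>4. schwartz_seminorm k n \<phi>)"
      by (intro sum_mono)
    also have "\<dots> \<le> (\<Sum>k\<le>4. \<Sum>n\<le>4. schwartz_seminorm k n \<phi>)"
      using nn by (intro sum_mono2 sum_nonneg) auto
    finally have "decay_const \<phi> \<le> 4 * (\<Sum>k\<le>4. \<Sum>n\<le>4. schwartz_seminorm k n \<phi>)"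
      using nn[of 0 0] nn[of 4 0] by (simp add: decay_const_def)
    from mult_left_mono[OF this K(1)] K(2)[OF \<phi>] show ?thesis
      using \<phi> by (simp add: function_distr_def mult_ac)
  qed
  then have "\<exists>C N. \<forall>\<phi>\<in>schwartz. \<bar>function_distr g \<phi>\<bar> \<le> C * (\<Sum>k\<le>N. \<Sum>n\<le>N. schwartz_seminorm k n \<phi>)" by blast
  moreover have "function_distr g (\<lambda>x. a * \<phi> x + b * \<psi> x) = a * function_distr g \<phi> + b * function_distr g \<psi>"
    if "\<phi> \<in> schwartz" "\<psi> \<in> schwartz" for \<phi> \<psi> a b
  proof -
    have "(LINT t|lborel. g t * (a * \<phi> t + b * \<psi> t)) = (LINT t|lborel. a * (g t * \<phi> t) + b * (g t * \<psi> t))"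
      by (simp add: algebra_simps)
    also have "\<dots> = a * (LINT t|lborel. g t * \<phi> t) + b * (LINT t|lborel. g t * \<psi> t)"
      using that[THEN integrable_linear_growth_schwartz[OF g]] by simp
    finally show ?thesis using that schwartz_linear[OF that] by (simp add: function_distr_def)
  qed
  ultimately show ?thesis
    by (simp add: tempered_distribution_def) (simp add: function_distr_def)
qed

lemma distr_deriv2_apply: "\<phi> \<in> schwartz \<Longrightarrow> distr_deriv (distr_deriv T) \<phi> = T (deriv (deriv \<phi>))"
  by (simp add: distr_deriv_def schwartz_deriv)

lemma integral_affine_deriv2:
  assumes "\<phi> \<in> schwartz"
  shows "(LINT t|lborel. (a + b * t) * deriv (deriv \<phi>) t) = 0"
proof -
  have s: "deriv \<phi> \<in> schwartz" "deriv (deriv \<phi>) \<in> schwartz" using assms by (auto intro: schwartz_deriv)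
  have i: "integrable lborel (\<lambda>t. t * deriv (deriv \<phi>) t)"
    by (rule integrable_linear_growth_schwartz[OF linear_growth_id s(2)])
  have "(LINT t|lborel. deriv (\<lambda>t. t * deriv \<phi> t) t) = 0"
    by (rule integral_schwartz_deriv[OF schwartz_times_id[OF s(1)]])
  moreover have "deriv (\<lambda>t. t * deriv \<phi> t) = (\<lambda>t. deriv \<phi> t + t * deriv (deriv \<phi>) t)"
    using funpow_deriv_times_id[OF s(1), of 1] by (auto simp: fun_eq_iff)
  ultimately have "(LINT t|lborel. t * deriv (deriv \<phi>) t) = 0"
    using i integrable_schwartz[OF s(1)] integral_schwartz_deriv[OF assms] by simp
  moreover have "(LINT t|lborel. (a + b * t) * deriv (deriv \<phi>) t)
      = (LINT t|lborel. a * deriv (deriv \<phi>) t + b * (t * deriv (deriv \<phi>) t))"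
    by (simp add: algebra_simps)
  ultimately show ?thesis
    using i integrable_schwartz[OF s(2)] integral_schwartz_deriv[OF s(1)] by simp
qed

lemma linear_growth_affine: "linear_growth (\<lambda>t. a + b * t)"
  by (intro linear_growth_add linear_growth_const linear_growth_cmult linear_growth_id)

lemma function_distr_BV2:
  assumes \<mu>: "\<mu> \<in> bounded_radon_measure" and g: "g = (\<lambda>t. a + b * t + ramp_potential \<mu> t)"
  shows "function_distr g \<in> BV2" "distr_deriv (distr_deriv (function_distr g)) = measure_distr \<mu>"
    "point_value (function_distr g) = g"
proof -
  have lg: "linear_growth g"
    unfolding g by (intro linear_growth_add[OF linear_growth_affine linear_growth_ramp_potential[OF \<mu>]])
  have "continuous_on UNIV g"
    unfolding g by (intro continuous_intros continuous_ramp_potential[OF \<mu>])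
  then show "point_value (function_distr g) = g"
    by (rule point_value_eq[OF _ represented_by_function_distr[OF lg]])
  show D: "distr_deriv (distr_deriv (function_distr g)) = measure_distr \<mu>"
  proof
    fix \<phi>
    show "distr_deriv (distr_deriv (function_distr g)) \<phi> = measure_distr \<mu> \<phi>"
    proof (cases "\<phi> \<in> schwartz")
      case True
      then have s: "deriv (deriv \<phi>) \<in> schwartz" by (intro schwartz_deriv)
      have "(LINT t|lborel. g t * deriv (deriv \<phi>) t)
          = (LINT t|lborel. (a + b * t) * deriv (deriv \<phi>) t) + (LINT t|lborel. ramp_potential \<mu> t * deriv (deriv \<phi>) t)"
        using integrable_linear_growth_schwartz[OF linear_growth_affine s, of a b]
          integrable_linear_growth_schwartz[OF linear_growth_ramp_potential[OF \<mu>] s]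
        unfolding g by (simp only: distrib_right[of "a + b * _"] Bochner_Integration.integral_add)
      then show ?thesis
        using True s integral_affine_deriv2[OF True, of a b] integral_ramp_potential_deriv2[OF \<mu> True]
        by (simp add: distr_deriv2_apply function_distr_def measure_distr_def)
    qed (simp add: distr_deriv_def measure_distr_def)
  qed
  show "function_distr g \<in> BV2"
    using function_distr_tempered[OF lg] D \<mu> by (auto simp: BV2_def)
qed

text \<open>A functional killed by \<open>D\<^sup>2\<close> vanishes on second derivatives of Schwartz functions, that is, on
  Schwartz functions with vanishing mean and first moment. Subtracting suitable multiples of a
  normalised bump and its derivative puts every Schwartz function into that form.\<close>

lemma affine_if_zero_on_deriv2:
  assumes lin: "\<And>\<phi> \<psi> a b. \<phi> \<in> schwartz \<Longrightarrow> \<psi> \<in> schwartz \<Longrightarrow> T (\<lambda>x. a * \<phi> x + b * \<psi> x) = a * T \<phi> + b * T \<psi>"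
    and zero: "\<And>\<phi>. \<phi> \<in> schwartz \<Longrightarrow> T (deriv (deriv \<phi>)) = (0::real)"
  obtains a b where "\<And>\<phi>. \<phi> \<in> schwartz \<Longrightarrow> T \<phi> = (LINT t|lborel. (a + b * t) * \<phi> t)"
proof -
  define \<beta> where "\<beta> = bump 1 (- 1) 1"
  have \<beta>: "\<beta> \<in> schwartz" by (simp add: \<beta>_def bump_schwartz)
  define c where "c = (LINT t|lborel. \<beta> t)"
  have "c \<noteq> 0"
  proof
    assume "c = 0"
    then have "AE t in lborel. \<beta> t = 0"
      using integral_nonneg_eq_0_iff_AE[OF integrable_schwartz[OF \<beta>]] bump_nonneg by (simp add: c_def \<beta>_def)
    then have "AE t in lborel. t \<notin> {-1<..<1::real}"
      by (simp add: \<beta>_def bump_eq_0_iff)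
    then have "emeasure lborel {-1<..<1::real} = 0"
      by (subst (asm) AE_iff_measurable[where N = "{-1<..<1}"]) auto
    then show False by (simp add: ennreal_eq_0_iff)
  qed
  define \<theta> where "\<theta> t = (1 / c) * \<beta> t + 0 * \<beta> t" for t
  have \<theta>: "\<theta> \<in> schwartz" unfolding \<theta>_def by (intro schwartz_linear \<beta>)
  have \<theta>': "deriv \<theta> \<in> schwartz" by (rule schwartz_deriv[OF \<theta>])
  have m0: "(LINT t|lborel. \<theta> t) = 1"
    using \<open>c \<noteq> 0\<close> by (simp add: \<theta>_def c_def)
  define m1 where "m1 = (LINT t|lborel. t * \<theta> t)"
  have m0': "(LINT t|lborel. deriv \<theta> t) = 0" by (rule integral_schwartz_deriv[OF \<theta>])
  note mom = integrable_linear_growth_schwartz[OF linear_growth_id]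
  have m1': "(LINT t|lborel. t * deriv \<theta> t) = - 1"
  proof -
    have "(LINT t|lborel. deriv (\<lambda>t. t * \<theta> t) t) = 0"
      by (rule integral_schwartz_deriv[OF schwartz_times_id[OF \<theta>]])
    moreover have "deriv (\<lambda>t. t * \<theta> t) = (\<lambda>t. \<theta> t + t * deriv \<theta> t)"
      using funpow_deriv_times_id[OF \<theta>, of 1] by (auto simp: fun_eq_iff)
    ultimately show ?thesis using m0 mom[OF \<theta>'] integrable_schwartz[OF \<theta>] by simp
  qed
  show thesis
  proof (rule that)
    fix \<phi> assume \<phi>: "\<phi> \<in> schwartz"
    \<comment> \<open>The coefficients are chosen so that \<open>\<psi>\<close> has the same mean and first moment as \<open>\<phi>\<close>.\<close>
    define p where "p = (LINT t|lborel. \<phi> t)"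
    define q where "q = p * m1 - (LINT t|lborel. t * \<phi> t)"
    define \<psi> where "\<psi> t = p * \<theta> t + q * deriv \<theta> t" for t
    define \<eta> where "\<eta> t = 1 * \<phi> t + (- 1) * \<psi> t" for t
    have \<psi>: "\<psi> \<in> schwartz" unfolding \<psi>_def by (intro schwartz_linear \<theta> \<theta>')
    have \<eta>: "\<eta> \<in> schwartz" unfolding \<eta>_def by (intro schwartz_linear \<phi> \<psi>)
    have "(LINT t|lborel. \<psi> t) = p"
      unfolding \<psi>_def using m0 m0' integrable_schwartz[OF \<theta>] integrable_schwartz[OF \<theta>'] by simp
    then have "(LINT t|lborel. \<eta> t) = 0"
      unfolding \<eta>_def using integrable_schwartz[OF \<phi>] integrable_schwartz[OF \<psi>] by (simp add: p_def)
    moreover have "(LINT t|lborel. t * \<psi> t) = (LINT t|lborel. p * (t * \<theta> t) + q * (t * deriv \<theta> t))"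
      unfolding \<psi>_def by (simp add: algebra_simps)
    then have "(LINT t|lborel. t * \<psi> t) = p * m1 - q"
      using m1' mom[OF \<theta>] mom[OF \<theta>'] by (simp add: m1_def)
    then have "(LINT t|lborel. t * \<eta> t) = 0"
      unfolding \<eta>_def using mom[OF \<phi>] mom[OF \<psi>] by (simp add: right_diff_distrib q_def)
    ultimately obtain \<Phi> where "\<Phi> \<in> schwartz" "deriv (deriv \<Phi>) = \<eta>"
      using schwartz_second_primitive[OF \<eta>] by blast
    then have "T \<eta> = 0" using zero[of \<Phi>] by simp
    then have "T \<phi> = T \<psi>"
      using lin[OF \<phi> \<psi>, of 1 "- 1"] by (simp add: \<eta>_def[abs_def])
    also have "\<dots> = p * T \<theta> + q * T (deriv \<theta>)"
      using lin[OF \<theta> \<theta>', of p q] by (simp add: \<psi>_def[abs_def])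
    also have "\<dots> = (T \<theta> + m1 * T (deriv \<theta>)) * p + (- T (deriv \<theta>)) * (LINT t|lborel. t * \<phi> t)"
      by (simp add: q_def algebra_simps)
    also have "\<dots> = (LINT t|lborel. (T \<theta> + m1 * T (deriv \<theta>)) * \<phi> t + (- T (deriv \<theta>)) * (t * \<phi> t))"
      using mom[OF \<phi>] integrable_schwartz[OF \<phi>] by (simp add: p_def)
    also have "\<dots> = (LINT t|lborel. ((T \<theta> + m1 * T (deriv \<theta>)) + (- T (deriv \<theta>)) * t) * \<phi> t)"
      by (simp add: algebra_simps)
    finally show "T \<phi> = (LINT t|lborel. ((T \<theta> + m1 * T (deriv \<theta>)) + (- T (deriv \<theta>)) * t) * \<phi> t)" .
  qed
qed

text \<open>Subtracting from \<open>f\<close> the potential of \<open>D\<^sup>2 f\<close> leaves a functional with vanishing second derivative.\<close>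

lemma BV2_representation:
  assumes f: "f \<in> BV2"
  obtains \<mu> a b where "\<mu> \<in> bounded_radon_measure" "distr_deriv (distr_deriv f) = measure_distr \<mu>"
    "point_value f = (\<lambda>t. a + b * t + ramp_potential \<mu> t)"
proof -
  obtain \<mu> where \<mu>: "\<mu> \<in> bounded_radon_measure" and D: "distr_deriv (distr_deriv f) = measure_distr \<mu>"
    using f by (auto simp: BV2_def)
  have ft: "f \<in> tempered_distribution" using f by (simp add: BV2_def)
  note lgp = linear_growth_ramp_potential[OF \<mu>]
  define h where "h = function_distr (ramp_potential \<mu>)"
  have ht: "h \<in> tempered_distribution" unfolding h_def by (rule function_distr_tempered[OF lgp])
  have Dh: "distr_deriv (distr_deriv h) = measure_distr \<mu>"
    unfolding h_def using function_distr_BV2(2)[OF \<mu>, of "ramp_potential \<mu>" 0 0] by simp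
  obtain a b where ab: "\<And>\<phi>. \<phi> \<in> schwartz \<Longrightarrow> f \<phi> - h \<phi> = (LINT t|lborel. (a + b * t) * \<phi> t)"
  proof (rule affine_if_zero_on_deriv2[of "\<lambda>\<phi>. f \<phi> - h \<phi>"])
    show "f (\<lambda>x. a * \<phi> x + b * \<psi> x) - h (\<lambda>x. a * \<phi> x + b * \<psi> x) = a * (f \<phi> - h \<phi>) + b * (f \<psi> - h \<psi>)"
      if "\<phi> \<in> schwartz" "\<psi> \<in> schwartz" for \<phi> \<psi> a b
      using ft ht that by (simp add: tempered_distribution_def algebra_simps)
    show "f (deriv (deriv \<phi>)) - h (deriv (deriv \<phi>)) = 0" if "\<phi> \<in> schwartz" for \<phi>
      using distr_deriv2_apply[OF that, of f] distr_deriv2_apply[OF that, of h] D Dh by simp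
  qed blast
  define g where "g = (\<lambda>t. a + b * t + ramp_potential \<mu> t)"
  have "represented_by f g"
    unfolding represented_by_def
  proof (intro ballI conjI)
    fix \<phi> assume \<phi>: "\<phi> \<in> schwartz"
    note i = integrable_linear_growth_schwartz[OF linear_growth_affine \<phi>, of a b]
      integrable_linear_growth_schwartz[OF lgp \<phi>]
    show "integrable lborel (\<lambda>t. g t * \<phi> t)"
      unfolding g_def distrib_right[of "a + b * _"] using i by (rule Bochner_Integration.integrable_add)
    have "(LINT t|lborel. g t * \<phi> t) = (f \<phi> - h \<phi>) + h \<phi>"
      unfolding g_def distrib_right[of "a + b * _"] Bochner_Integration.integral_add[OF i]
      using ab[OF \<phi>] \<phi> by (simp add: h_def function_distr_def)
    then show "f \<phi> = (LINT t|lborel. g t * \<phi> t)" by simp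
  qed
  moreover have "continuous_on UNIV g"
    unfolding g_def by (intro continuous_intros continuous_ramp_potential[OF \<mu>])
  ultimately have "point_value f = g" by (intro point_value_eq)
  with \<mu> D show thesis unfolding g_def by (rule that)
qed

section \<open>Minimal second-derivative norm of an interpolant\<close>

definition slope :: "(nat \<Rightarrow> real) \<Rightarrow> (nat \<Rightarrow> real) \<Rightarrow> nat \<Rightarrow> real" where
  "slope x z m = (z (Suc m) - z m) / (x (Suc m) - x m)"

text \<open>The total variation of the second derivative of the polygon through the points \<open>(x m, z m)\<close>,
  \<open>1 \<le> m \<le> M\<close>, continued affinely beyond the outer nodes: the kinks sit at the inner nodes.\<close>

definition kink_sum :: "nat \<Rightarrow> (nat \<Rightarrow> real) \<Rightarrow> (nat \<Rightarrow> real) \<Rightarrow> real" where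
  "kink_sum M x z = (\<Sum>m\<in>{2..<M}. \<bar>slope x z m - slope x z (m - 1)\<bar>)"

lemma slope_cong: "z m = w m \<Longrightarrow> z (Suc m) = w (Suc m) \<Longrightarrow> slope x z m = slope x w m"
  by (simp add: slope_def)

lemma kink_sum_cong:
  assumes "\<And>m. m \<in> {1..M} \<Longrightarrow> z m = w m"
  shows "kink_sum M x z = kink_sum M x w"
  unfolding kink_sum_def
proof (rule sum.cong)
  fix m assume m: "m \<in> {2..<M}"
  then have "Suc (m - 1) = m" by auto
  then show "\<bar>slope x z m - slope x z (m - 1)\<bar> = \<bar>slope x w m - slope x w (m - 1)\<bar>"
    using m by (subst (1 2) slope_cong[of z _ w]) (auto intro!: assms)
qed simp

lemma telescope_slopes:
  fixes S :: "nat \<Rightarrow> real"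
  assumes "2 \<le> n"
  shows "(\<Sum>m\<in>{2..<n}. S m - S (m - 1)) = S (n - 1) - S 1"
  using sum_Suc_diff'[of 2 n "\<lambda>m. S (m - 1)"] assms by simp

text \<open>By convexity of the ramp \<open>t \<mapsto> max 0 (t - s)\<close> its difference quotients increase along the nodes, from
  at least \<open>0\<close> to at most \<open>1\<close>; hence their total oscillation is at most \<open>1\<close>, whatever \<open>s\<close> is.\<close>

lemma ramp_slopes_variation:
  assumes M: "2 \<le> M" and x: "strict_mono_on {1..M} x"
  shows "(\<Sum>m\<in>{2..<M}. \<bar>slope x (\<lambda>i. ramp_kernel (x i) s) m - slope x (\<lambda>i. ramp_kernel (x i) s) (m - 1)\<bar>) \<le> 1"
proof -
  define S where "S = slope x (\<lambda>i. ramp_kernel (x i) s)"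
  have dx: "x m < x (Suc m)" if "m \<in> {1..<M}" for m
    using strict_mono_onD[OF x, of m "Suc m"] that by auto
  have S_eq: "S m = (max 0 (x (Suc m) - s) - max 0 (x m - s)) / (x (Suc m) - x m)" for m
    by (simp add: S_def slope_def ramp_kernel_def)
  have S01: "0 \<le> S m" "S m \<le> 1" if "m \<in> {1..<M}" for m
    using dx[OF that] by (auto simp: S_eq max_def field_simps)
  have mono: "S (m - 1) \<le> S m" if m: "m \<in> {2..<M}" for m
  proof -
    have m1: "m - 1 \<in> {1..<M}" "m \<in> {1..<M}" "Suc (m - 1) = m" using m by auto
    show ?thesis
    proof (cases "s \<le> x m")
      case True
      then have "S m = 1" using dx[OF m1(2)] by (simp add: S_eq max_def)
      then show ?thesis using S01(2)[OF m1(1)] by simp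
    next
      case False
      then have "S (m - 1) = 0" using dx[OF m1(1)] m1(3) by (simp add: S_eq max_def)
      then show ?thesis using S01(1)[OF m1(2)] by simp
    qed
  qed
  have "(\<Sum>m\<in>{2..<M}. \<bar>S m - S (m - 1)\<bar>) = (\<Sum>m\<in>{2..<M}. S m - S (m - 1))"
    using mono by (intro sum.cong) auto
  also have "\<dots> = S (M - 1) - S 1"
    by (rule telescope_slopes[OF M])
  also have "\<dots> \<le> 1"
  proof -
    have "M - 1 \<in> {1..<M}" "1 \<in> {1..<M}" using M by auto
    then show ?thesis using S01 by fastforce
  qed
  finally show ?thesis by (simp add: S_def)
qed

text \<open>In the differences of neighbouring slopes the affine part of \<open>f\<close> cancels, and what remains is the
  integral against \<open>D\<^sup>2 f\<close> of the corresponding slope difference of the ramps. Summing under the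
  integral leaves the slope variation of a single ramp.\<close>

lemma kink_sum_le_norm_M:
  assumes M: "2 \<le> M" and x: "strict_mono_on {1..M} x" and f: "f \<in> BV2"
  shows "kink_sum M x (\<lambda>m. point_value f (x m)) \<le> norm_M (distr_deriv (distr_deriv f))"
proof -
  obtain \<mu> a b where \<mu>: "\<mu> \<in> bounded_radon_measure" and D: "distr_deriv (distr_deriv f) = measure_distr \<mu>"
    and pv: "point_value f = (\<lambda>t. a + b * t + ramp_potential \<mu> t)"
    using BV2_representation[OF f] .
  obtain \<nu> \<sigma> where "polar_form \<nu> \<mu> \<sigma>" using polar_decomposition[OF \<mu>] .
  then interpret polar_form \<nu> \<mu> \<sigma> .
  have dx: "x m < x (Suc m)" if "m \<in> {1..<M}" for m
    using strict_mono_onD[OF x, of m "Suc m"] that by auto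
  define S where "S m s = slope x (\<lambda>i. ramp_kernel (x i) s) m" for m s
  have intk: "integrable \<nu> (\<lambda>s. \<sigma> s * ramp_kernel t s)" for t
    by (rule integrable_const_bound[of _ "\<bar>t\<bar>"]) (auto simp: abs_mult abs_sign ramp_kernel_bound)
  have S_eq: "\<sigma> s * S m s = (\<sigma> s * ramp_kernel (x (Suc m)) s - \<sigma> s * ramp_kernel (x m) s) / (x (Suc m) - x m)" for m s
    by (simp add: S_def slope_def right_diff_distrib)
  have intS: "integrable \<nu> (\<lambda>s. \<sigma> s * S m s)" for m
    unfolding S_eq by (intro integrable_divide Bochner_Integration.integrable_diff intk)
  have pot: "slope x (\<lambda>i. point_value f (x i)) m = b + (LINT s|\<nu>. \<sigma> s * S m s)" if "m \<in> {1..<M}" for m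
  proof -
    have "ramp_potential \<mu> t = (LINT s|\<nu>. \<sigma> s * ramp_kernel t s)" for t
      by (simp add: ramp_potential_def signed_integral_eq bounded_ramp_kernel ramp_kernel_borel)
    then have "(LINT s|\<nu>. \<sigma> s * S m s) = (ramp_potential \<mu> (x (Suc m)) - ramp_potential \<mu> (x m)) / (x (Suc m) - x m)"
      unfolding S_eq by (simp add: intk)
    then show ?thesis
      using dx[OF that] by (simp add: pv slope_def field_simps)
  qed
  have intd: "integrable \<nu> (\<lambda>s. \<bar>S m s - S (m - 1) s\<bar>)" for m
  proof -
    have "integrable \<nu> (\<lambda>s. \<bar>\<sigma> s * S m s - \<sigma> s * S (m - 1) s\<bar>)"
      by (intro integrable_abs Bochner_Integration.integrable_diff intS)
    then show ?thesis by (simp add: right_diff_distrib[symmetric] abs_mult abs_sign)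
  qed
  have "kink_sum M x (\<lambda>m. point_value f (x m)) \<le> (\<Sum>m\<in>{2..<M}. LINT s|\<nu>. \<bar>S m s - S (m - 1) s\<bar>)"
    unfolding kink_sum_def
  proof (rule sum_mono)
    fix m assume m: "m \<in> {2..<M}"
    have "slope x (\<lambda>m. point_value f (x m)) m - slope x (\<lambda>m. point_value f (x m)) (m - 1)
        = (LINT s|\<nu>. \<sigma> s * S m s - \<sigma> s * S (m - 1) s)"
      using m by (subst Bochner_Integration.integral_diff[OF intS intS]) (subst (1 2) pot, auto)
    also have "\<bar>\<dots>\<bar> \<le> (LINT s|\<nu>. \<bar>\<sigma> s * S m s - \<sigma> s * S (m - 1) s\<bar>)"
      by (rule integral_abs_bound)
    finally show "\<bar>slope x (\<lambda>m. point_value f (x m)) m - slope x (\<lambda>m. point_value f (x m)) (m - 1)\<bar>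
        \<le> (LINT s|\<nu>. \<bar>S m s - S (m - 1) s\<bar>)"
      by (simp add: right_diff_distrib[symmetric] abs_mult abs_sign)
  qed
  also have "\<dots> = (LINT s|\<nu>. (\<Sum>m\<in>{2..<M}. \<bar>S m s - S (m - 1) s\<bar>))"
    by (rule Bochner_Integration.integral_sum[symmetric]) (rule intd)
  also have "\<dots> \<le> (LINT s|\<nu>. 1)"
    by (intro integral_mono Bochner_Integration.integrable_sum intd)
      (use ramp_slopes_variation[OF M x] in \<open>auto simp: S_def\<close>)
  also have "\<dots> = norm_M (distr_deriv (distr_deriv f))"
    by (simp add: D norm_M_measure_distr[OF \<mu>] total_variation_eq)
  finally show ?thesis .
qed

definition discrete_measure :: "'i set \<Rightarrow> ('i \<Rightarrow> real) \<Rightarrow> ('i \<Rightarrow> real) \<Rightarrow> real set \<Rightarrow> real" where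
  "discrete_measure I c p = (\<lambda>A\<in>sets borel. \<Sum>i\<in>I. c i * indicator A (p i))"

lemma discrete_measure_bounded_radon: "discrete_measure I c p \<in> bounded_radon_measure"
proof -
  have "(\<lambda>n. \<Sum>i\<in>I. c i * indicator (A n) (p i)) sums (\<Sum>i\<in>I. c i * indicator (\<Union>n. A n) (p i))"
    if A: "disjoint_family A" for A :: "nat \<Rightarrow> real set"
  proof (intro sums_sum sums_mult)
    fix i
    show "(\<lambda>n. indicator (A n) (p i) :: real) sums indicator (\<Union>n. A n) (p i)"
    proof (cases "p i \<in> (\<Union>n. A n)")
      case True
      then obtain k where k: "p i \<in> A k" by auto
      then have "indicator (A n) (p i) = (if n = k then 1 else 0 :: real)" for n
        using A by (auto simp: disjoint_family_on_def indicator_def)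
      then show ?thesis using True sums_single[of k "\<lambda>_. 1::real"] by (simp add: eq_commute[of k])
    qed (auto simp: indicator_def)
  qed
  moreover have "discrete_measure I c p A = (\<Sum>i\<in>I. c i * indicator A (p i))" if "A \<in> sets borel" for A
    using that by (simp add: discrete_measure_def)
  ultimately show ?thesis
    unfolding bounded_radon_measure_def
  proof (intro CollectI conjI allI impI)
    show "discrete_measure I c p \<in> extensional (sets borel)"
      by (simp add: discrete_measure_def)
  qed (simp add: range_subsetD sets.countable_UN)
qed

lemma total_variation_discrete_measure_le:
  assumes "finite I"
  shows "total_variation (discrete_measure I c p) \<le> (\<Sum>i\<in>I. \<bar>c i\<bar>)"
  unfolding total_variation_def
proof (rule cSUP_least)
  show "{P. finite P \<and> P \<subseteq> sets (borel::real measure) \<and> disjoint P} \<noteq> {}"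
    by (auto intro!: exI[of _ "{}"])
  fix P assume "P \<in> {P. finite P \<and> P \<subseteq> sets (borel::real measure) \<and> disjoint P}"
  then have P: "finite P" "P \<subseteq> sets borel" "disjoint P" by auto
  have "(\<Sum>A\<in>P. \<bar>discrete_measure I c p A\<bar>) \<le> (\<Sum>A\<in>P. \<Sum>i\<in>I. \<bar>c i\<bar> * indicator A (p i))"
  proof (rule sum_mono)
    fix A assume "A \<in> P"
    then have "\<bar>discrete_measure I c p A\<bar> = \<bar>\<Sum>i\<in>I. c i * indicator A (p i)\<bar>"
      using P by (auto simp: discrete_measure_def)
    also have "\<dots> \<le> (\<Sum>i\<in>I. \<bar>c i * indicator A (p i)\<bar>)" by (rule sum_abs)
    finally show "\<bar>discrete_measure I c p A\<bar> \<le> (\<Sum>i\<in>I. \<bar>c i\<bar> * indicator A (p i))"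
      by (simp add: abs_mult)
  qed
  also have "\<dots> = (\<Sum>i\<in>I. \<bar>c i\<bar> * (\<Sum>A\<in>P. indicator A (p i)))"
    by (subst sum.swap) (simp add: sum_distrib_left)
  also have "\<dots> \<le> (\<Sum>i\<in>I. \<bar>c i\<bar> * 1)"
  proof (intro sum_mono mult_left_mono)
    fix i
    have "(\<Sum>A\<in>P. indicator A (p i)) = (indicator (\<Union>A\<in>P. A) (p i) :: real)"
      using P by (intro indicator_UN_disjoint[symmetric]) (auto simp: disjoint_family_on_def disjoint_def)
    then show "(\<Sum>A\<in>P. indicator A (p i)) \<le> (1::real)" by (simp add: indicator_def)
  qed simp
  finally show "(\<Sum>A\<in>P. \<bar>discrete_measure I c p A\<bar>) \<le> (\<Sum>i\<in>I. \<bar>c i\<bar>)" by simp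
qed

text \<open>The variation \<open>\<nu>\<close> does not charge the complement of the support \<open>F\<close>: on the part of it where the sign
  \<open>\<sigma>\<close> is constant, \<open>\<nu>\<close> agrees with \<open>\<mu>\<close> up to sign, and \<open>\<mu>\<close> vanishes there. So \<open>\<phi>\<close> may be replaced by a
  combination of indicators of points.\<close>

lemma signed_integral_discrete_measure:
  assumes I: "finite I" and \<phi>: "\<phi> \<in> borel_measurable borel" "bounded (range \<phi>)"
  shows "signed_integral (discrete_measure I c p) \<phi> = (\<Sum>i\<in>I. c i * \<phi> (p i))"
proof -
  define \<mu> where "\<mu> = discrete_measure I c p"
  obtain \<nu> \<sigma> where "polar_form \<nu> \<mu> \<sigma>" using polar_decomposition[OF discrete_measure_bounded_radon[of I c p, folded \<mu>_def]] .
  then interpret polar_form \<nu> \<mu> \<sigma> .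
  note \<phi>(1)[measurable]
  define F where "F = p ` I"
  have F: "finite F" "F \<in> sets borel" using I by (auto simp: F_def intro: finite_imp_closed borel_closed)
  have null: "measure \<nu> {t. \<sigma> t = e \<and> t \<notin> F} = 0" if e: "\<bar>e\<bar> = 1" for e
  proof -
    define A where "A = {t. \<sigma> t = e \<and> t \<notin> F}"
    have A[measurable]: "A \<in> sets borel"
    proof -
      have "A = {t \<in> space borel. \<sigma> t = e} - F" by (auto simp: A_def)
      then show ?thesis using F(2) by simp
    qed
    have "\<mu> A = 0"
      using A by (auto simp: \<mu>_def discrete_measure_def A_def F_def intro!: sum.neutral)
    moreover have "(LINT t|\<nu>. \<sigma> t * indicator A t) = (LINT t|\<nu>. e * indicator A t)"
      by (intro Bochner_Integration.integral_cong) (auto simp: A_def indicator_def)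
    ultimately show ?thesis using measure_eq[OF A] e by (auto simp: A_def[symmetric])
  qed
  have "AE t in \<nu>. \<not> (\<sigma> t = e \<and> t \<notin> F)" if "\<bar>e\<bar> = 1" for e
  proof (rule AE_I[of _ _ "{t. \<sigma> t = e \<and> t \<notin> F}"])
    have "{t. \<sigma> t = e \<and> t \<notin> F} = {t \<in> space borel. \<sigma> t = e} - F" by auto
    then show "{t. \<sigma> t = e \<and> t \<notin> F} \<in> sets \<nu>" using F(2) by simp
    show "emeasure \<nu> {t. \<sigma> t = e \<and> t \<notin> F} = 0" using null[OF that] by (simp add: emeasure_eq_measure)
  qed simp
  then have "AE t in \<nu>. \<not> (\<sigma> t = 1 \<and> t \<notin> F)" "AE t in \<nu>. \<not> (\<sigma> t = - 1 \<and> t \<notin> F)"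
    by simp_all
  then have AEF: "AE t in \<nu>. t \<in> F"
  proof eventually_elim
    case (elim t)
    then show ?case using abs_sign[of t] by linarith
  qed
  have intF: "integrable \<nu> (\<lambda>t. \<sigma> t * indicator {u} t)" for u
    by (rule integrable_const_bound[of _ 1]) (auto simp: abs_mult abs_sign indicator_def)
  have "signed_integral \<mu> \<phi> = (LINT t|\<nu>. \<sigma> t * \<phi> t)" by (rule signed_integral_eq[OF \<phi>])
  also have "\<dots> = (LINT t|\<nu>. (\<Sum>u\<in>F. \<phi> u * (\<sigma> t * indicator {u} t)))"
  proof (rule integral_cong_AE)
    show "AE t in \<nu>. \<sigma> t * \<phi> t = (\<Sum>u\<in>F. \<phi> u * (\<sigma> t * indicator {u} t))"
      using AEF
    proof eventually_elim
      case (elim t)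
      have "(\<Sum>u\<in>F. \<phi> u * (\<sigma> t * indicator {u} t)) = (\<Sum>u\<in>F. if t = u then \<phi> u * \<sigma> t else 0)"
        by (intro sum.cong) (auto simp: indicator_def)
      then show ?case using elim F(1) by simp
    qed
  qed measurable
  also have "\<dots> = (\<Sum>u\<in>F. \<phi> u * \<mu> {u})"
    by (simp add: measure_eq intF)
  also have "\<dots> = (\<Sum>u\<in>F. \<Sum>i\<in>I. if p i = u then c i * \<phi> u else 0)"
    by (simp add: \<mu>_def discrete_measure_def sum_distrib_left) (auto intro!: sum.cong simp: indicator_def)
  also have "\<dots> = (\<Sum>i\<in>I. \<Sum>u\<in>F. if p i = u then c i * \<phi> u else 0)"
    by (rule sum.swap)
  also have "\<dots> = (\<Sum>i\<in>I. c i * \<phi> (p i))"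
    using F(1) by (intro sum.cong) (auto simp: F_def)
  finally show ?thesis by (simp add: \<mu>_def)
qed

text \<open>The polygon is the affine function through the first two points plus the potential of the point
  masses given by the slope changes; the interpolation conditions then follow from node to node. Only
  the inequality \<open>\<le>\<close> for the norm is computed, the other one being the general lower bound.\<close>

lemma piecewise_linear_interpolant:
  assumes M: "2 \<le> M" and x: "strict_mono_on {1..M} x"
  shows "\<exists>f\<in>BV2. (\<forall>m\<in>{1..M}. point_value f (x m) = z m) \<and>
    norm_M (distr_deriv (distr_deriv f)) = kink_sum M x z"
proof -
  have dx: "x m < x (Suc m)" if "m \<in> {1..<M}" for m
    using strict_mono_onD[OF x, of m "Suc m"] that by auto
  have xle: "x i \<le> x j" if "1 \<le> i" "i \<le> j" "j \<le> M" for i j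
    using strict_mono_on_leD[OF x, of i j] that by auto
  define c where "c m = slope x z m - slope x z (m - 1)" for m
  define \<mu> where "\<mu> = discrete_measure {2..<M} c x"
  have \<mu>: "\<mu> \<in> bounded_radon_measure" unfolding \<mu>_def by (rule discrete_measure_bounded_radon)
  have pot: "ramp_potential \<mu> t = (\<Sum>m\<in>{2..<M}. c m * ramp_kernel t (x m))" for t
    unfolding ramp_potential_def \<mu>_def
    by (rule signed_integral_discrete_measure) (simp_all add: ramp_kernel_borel bounded_ramp_kernel)
  define b where "b = slope x z 1"
  define a where "a = z 1 - b * x 1 - ramp_potential \<mu> (x 1)"
  define g where "g = (\<lambda>t. a + b * t + ramp_potential \<mu> t)"
  note f = function_distr_BV2[OF \<mu> g_def]
  have val: "g (x (Suc m)) = z (Suc m)" if "m < M" for m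
    using that
  proof (induction m)
    case 0
    then show ?case by (simp add: g_def a_def)
  next
    case (Suc m)
    define j where "j = Suc m"
    have j: "j \<in> {1..<M}" using Suc.prems by (auto simp: j_def)
    have "ramp_potential \<mu> (x (Suc j)) - ramp_potential \<mu> (x j)
        = (\<Sum>m\<in>{2..<M}. c m * (max 0 (x (Suc j) - x m) - max 0 (x j - x m)))"
      by (simp add: pot sum_subtractf[symmetric] ramp_kernel_def right_diff_distrib)
    also have "\<dots> = (\<Sum>m\<in>{2..<M}. if m \<in> {2..<Suc j} then c m * (x (Suc j) - x j) else 0)"
    proof (rule sum.cong)
      fix m assume m: "m \<in> {2..<M}"
      show "c m * (max 0 (x (Suc j) - x m) - max 0 (x j - x m))
          = (if m \<in> {2..<Suc j} then c m * (x (Suc j) - x j) else 0)"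
      proof (cases "m \<le> j")
        case True
        then show ?thesis using m j xle[of m j] dx[OF j] by auto
      next
        case False
        then show ?thesis using m j xle[of "Suc j" m] dx[OF j] by auto
      qed
    qed simp
    also have "\<dots> = (\<Sum>m\<in>{2..<Suc j}. c m * (x (Suc j) - x j))"
      using j by (subst sum.inter_restrict[symmetric]) (auto intro!: sum.cong)
    also have "\<dots> = (slope x z j - slope x z 1) * (x (Suc j) - x j)"
      using telescope_slopes[of "Suc j" "slope x z"] j
      by (simp add: sum_distrib_right[symmetric] c_def)
    finally have "g (x (Suc j)) - g (x j) = slope x z j * (x (Suc j) - x j)"
      by (simp add: g_def b_def algebra_simps)
    also have "\<dots> = z (Suc j) - z j"
      using dx[OF j] by (simp add: slope_def)
    finally show ?case using Suc by (simp add: j_def)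
  qed
  have vals: "point_value (function_distr g) (x m) = z m" if "m \<in> {1..M}" for m
    using val[of "m - 1"] that by (cases m) (auto simp: f(3))
  have "norm_M (distr_deriv (distr_deriv (function_distr g))) \<le> kink_sum M x z"
    unfolding f(2) norm_M_measure_distr[OF \<mu>]
    using total_variation_discrete_measure_le[of "{2..<M}" c x] by (simp add: kink_sum_def c_def \<mu>_def)
  moreover have "kink_sum M x z \<le> norm_M (distr_deriv (distr_deriv (function_distr g)))"
    using kink_sum_le_norm_M[OF M x f(1)] vals by (subst kink_sum_cong[where w = "\<lambda>m. point_value (function_distr g) (x m)"]) auto
  ultimately show ?thesis using f(1) vals by (intro bexI[of _ "function_distr g"]) auto
qed

section \<open>The finite-dimensional problem for the values at the nodes\<close>

text \<open>The values are given by a function on all of \<open>nat\<close>, of which only the arguments in \<open>{1..M}\<close> matter; this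
  makes the product topology on functions available for the compactness argument.\<close>

definition value_cost ::
  "(real \<Rightarrow> real \<Rightarrow> real) \<Rightarrow> real \<Rightarrow> nat \<Rightarrow> (nat \<Rightarrow> real) \<Rightarrow> (nat \<Rightarrow> real) \<Rightarrow> (nat \<Rightarrow> real) \<Rightarrow> real" where
  "value_cost E lam M x y z = (\<Sum>m=1..M. E (z m) (y m)) + lam * kink_sum M x z"

lemma value_cost_cong:
  "(\<And>m. m \<in> {1..M} \<Longrightarrow> z m = w m) \<Longrightarrow> value_cost E lam M x y z = value_cost E lam M x y w"
  unfolding value_cost_def using kink_sum_cong[of M z w x] by simp

lemma kink_sum_nonneg: "0 \<le> kink_sum M x z"
  by (auto simp: kink_sum_def intro!: sum_nonneg)

lemma kink_sum_midpoint_le: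
  "kink_sum M x (\<lambda>m. (z m + w m) / 2) \<le> (kink_sum M x z + kink_sum M x w) / 2"
proof -
  have avg: "slope x (\<lambda>m. (z m + w m) / 2) m = (slope x z m + slope x w m) / 2" for m
    by (simp add: slope_def add_divide_distrib[symmetric] diff_divide_distrib[symmetric] add_diff_add mult.commute)
  have "kink_sum M x (\<lambda>m. (z m + w m) / 2)
      = (\<Sum>m\<in>{2..<M}. \<bar>(slope x z m - slope x z (m - 1)) + (slope x w m - slope x w (m - 1))\<bar> / 2)"
    by (simp only: kink_sum_def avg diff_divide_distrib[symmetric] add_diff_add abs_divide abs_numeral)
  also have "\<dots> \<le> (\<Sum>m\<in>{2..<M}. (\<bar>slope x z m - slope x z (m - 1)\<bar> + \<bar>slope x w m - slope x w (m - 1)\<bar>) / 2)"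
    by (intro sum_mono divide_right_mono abs_triangle_ineq) simp
  also have "\<dots> = (kink_sum M x z + kink_sum M x w) / 2"
    by (simp add: kink_sum_def sum_divide_distrib[symmetric] sum.distrib)
  finally show ?thesis .
qed

text \<open>If two minimizers differed at a node, their midpoint would be strictly better.\<close>

lemma value_cost_minimizer_unique:
  assumes conv: "\<And>t. strictly_convex (\<lambda>s. E s t)" and lam: "lam > 0"
    and z: "\<And>u. value_cost E lam M x y z \<le> value_cost E lam M x y u"
    and w: "value_cost E lam M x y w \<le> value_cost E lam M x y z"
    and m: "m \<in> {1..M}"
  shows "w m = z m"
proof (rule ccontr)
  assume ne: "w m \<noteq> z m"
  have half: "E ((z i + w i) / 2) (y i) < (E (z i) (y i) + E (w i) (y i)) / 2" if "z i \<noteq> w i" for i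
  proof -
    have "E ((1 - 1 / 2) * z i + 1 / 2 * w i) (y i) < (1 - 1 / 2) * E (z i) (y i) + 1 / 2 * E (w i) (y i)"
      using conv[of "y i", unfolded strictly_convex_def, rule_format, of "z i" "w i" "1 / 2"] that by simp
    then show ?thesis by (simp add: add_divide_distrib)
  qed
  have "(\<Sum>i=1..M. E ((z i + w i) / 2) (y i)) < (\<Sum>i=1..M. (E (z i) (y i) + E (w i) (y i)) / 2)"
  proof (rule sum_strict_mono_ex1)
    show "\<forall>i\<in>{1..M}. E ((z i + w i) / 2) (y i) \<le> (E (z i) (y i) + E (w i) (y i)) / 2"
    proof
      fix i show "E ((z i + w i) / 2) (y i) \<le> (E (z i) (y i) + E (w i) (y i)) / 2"
        by (cases "z i = w i") (use half[of i] in auto)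
    qed
    show "\<exists>i\<in>{1..M}. E ((z i + w i) / 2) (y i) < (E (z i) (y i) + E (w i) (y i)) / 2"
      using half[of m] ne m by auto
  qed simp
  moreover have "lam * kink_sum M x (\<lambda>m. (z m + w m) / 2) \<le> lam * ((kink_sum M x z + kink_sum M x w) / 2)"
    using lam by (intro mult_left_mono kink_sum_midpoint_le) auto
  ultimately have "value_cost E lam M x y (\<lambda>m. (z m + w m) / 2) < (value_cost E lam M x y z + value_cost E lam M x y w) / 2"
    unfolding value_cost_def by (simp add: sum_divide_distrib[symmetric] sum.distrib field_simps)
  then show False using z[of "\<lambda>m. (z m + w m) / 2"] w by simp
qed

text \<open>Outside a large box some value \<open>w m\<close> is so large that the single term \<open>E (w m) (y m)\<close> already exceeds
  the cost of \<open>z = 0\<close>; inside the box compactness applies.\<close>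

lemma value_cost_minimizer_exists:
  assumes nonneg: "\<And>s t. E s t \<ge> 0"
    and coer: "\<And>t. coercive (\<lambda>s. E s t)"
    and diff: "\<And>t s. (\<lambda>s. E s t) differentiable (at s)"
    and lam: "lam > 0"
  shows "\<exists>z. \<forall>w. value_cost E lam M x y z \<le> value_cost E lam M x y w"
proof -
  define G where "G = value_cost E lam M x y"
  have contE: "continuous_on UNIV (\<lambda>s. E s t)" for t
    using diff by (intro continuous_at_imp_continuous_on) (auto intro: differentiable_imp_continuous_within)
  have contc: "continuous_on UNIV (\<lambda>z :: nat \<Rightarrow> real. E (z m) (y m))" for m
    by (rule continuous_on_compose2[OF contE[of "y m"] continuous_on_product_coordinates]) simp
  have contG: "continuous_on UNIV G"
    unfolding G_def value_cost_def kink_sum_def slope_def divide_inverse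
    by (intro continuous_intros contc continuous_on_product_coordinates)
  have "\<exists>R. \<forall>s. R \<le> \<bar>s\<bar> \<longrightarrow> G (\<lambda>_. 0) < E s (y m)" for m
  proof -
    have "\<forall>\<^sub>F s in at_infinity. G (\<lambda>_. 0) < E s (y m)"
      using coer[of "y m"] by (simp add: coercive_def filterlim_at_top_dense)
    then show ?thesis by (simp add: eventually_at_infinity)
  qed
  then obtain R where R: "\<And>m s. R m \<le> \<bar>s\<bar> \<Longrightarrow> G (\<lambda>_. 0) < E s (y m)" by metis
  define r where "r = Max (insert 0 (R ` {1..M}))"
  have r: "R m \<le> r" if "m \<in> {1..M}" for m
    using that unfolding r_def by (intro Max_ge) auto
  have r0: "0 \<le> r" by (simp add: r_def)
  define K where "K = PiE (UNIV :: nat set) (\<lambda>_. {- r..r})"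
  have "compact K"
    unfolding K_def compactin_euclidean_iff[symmetric] euclidean_product_topology[symmetric] compactin_PiE
    by simp
  moreover have K0: "(\<lambda>_. 0) \<in> K" using r0 by (auto simp: K_def)
  ultimately obtain z where z: "z \<in> K" "\<And>w. w \<in> K \<Longrightarrow> G z \<le> G w"
    using continuous_attains_inf[of K G] continuous_on_subset[OF contG] by auto
  have "G z \<le> G w" for w
  proof -
    \<comment> \<open>The coordinates that do not enter the cost are set to \<open>0\<close>, so that leaving the box is due to a node.\<close>
    define w' where "w' m = (if m \<in> {1..M} then w m else 0)" for m
    have eq: "G w' = G w" unfolding G_def by (rule value_cost_cong) (simp add: w'_def)
    show ?thesis
    proof (cases "w' \<in> K")
      case True
      then show ?thesis using z(2) eq by metis
    next
      case False
      then obtain m where m: "w' m \<notin> {- r..r}" unfolding K_def by blast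
      then have mM: "m \<in> {1..M}" using r0 by (auto simp: w'_def split: if_splits)
      then have "R m \<le> \<bar>w m\<bar>" using m r[OF mM] by (auto simp: w'_def)
      then have "G (\<lambda>_. 0) < E (w m) (y m)" by (rule R)
      also have "\<dots> \<le> (\<Sum>m=1..M. E (w m) (y m))"
        using mM nonneg by (intro member_le_sum[of m "{1..M}" "\<lambda>m. E (w m) (y m)"]) auto
      also have "\<dots> \<le> G w"
        unfolding G_def value_cost_def using kink_sum_nonneg[of M x w] lam by simp
      finally show ?thesis using z(2)[OF K0] by simp
    qed
  qed
  then show ?thesis unfolding G_def by blast
qed

section \<open>The solutions of the regularized problem\<close>

theorem proposition7:
  fixes M :: nat and x y :: "nat \<Rightarrow> real"
    and E :: "real \<Rightarrow> real \<Rightarrow> real" and lam :: real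
  assumes "M \<ge> 2"
    and "strict_mono_on {1..M} x"
    and "\<And>s t. E s t \<ge> 0"
    and "\<And>t. strictly_convex (\<lambda>s. E s t)"
    and "\<And>t. coercive (\<lambda>s. E s t)"
    and "\<And>t s. (\<lambda>s. E s t) differentiable (at s)"
    and "lam > 0"
  shows "(\<exists>!z. z \<in> extensional {1..M} \<and>
            (\<forall>f \<in> gblasso_solutions E lam M x y. \<forall>m\<in>{1..M}. point_value f (x m) = z m)) \<and>
         (\<forall>z \<in> extensional {1..M}.
            (\<forall>f \<in> gblasso_solutions E lam M x y. \<forall>m\<in>{1..M}. point_value f (x m) = z m) \<longrightarrow>
            gblasso_solutions E lam M x y =
              {f. is_arg_min (\<lambda>f. norm_M (distr_deriv (distr_deriv f)))
                    (\<lambda>f. f \<in> BV2 \<and> (\<forall>m\<in>{1..M}. point_value f (x m) = z m)) f})"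
proof -
  note M = assms(1) and x = assms(2) and lam = assms(7)
  let ?V = "gblasso_solutions E lam M x y"
  let ?N = "\<lambda>f. norm_M (distr_deriv (distr_deriv f))"
  define vals where "vals f m = point_value f (x m)" for f m
  define G where "G = value_cost E lam M x y"
  have "\<exists>z. \<forall>w. G z \<le> G w"
    unfolding G_def by (rule value_cost_minimizer_exists[OF assms(3,5,6,7)])
  then obtain z\<^sub>0 where z\<^sub>0: "\<And>w. G z\<^sub>0 \<le> G w" by auto
  obtain f\<^sub>0 where f\<^sub>0: "f\<^sub>0 \<in> BV2" "\<And>m. m \<in> {1..M} \<Longrightarrow> point_value f\<^sub>0 (x m) = z\<^sub>0 m" "?N f\<^sub>0 = kink_sum M x z\<^sub>0"
    using piecewise_linear_interpolant[OF M x, of z\<^sub>0] by auto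
  have lower: "kink_sum M x (vals f) \<le> ?N f" if "f \<in> BV2" for f
    using kink_sum_le_norm_M[OF M x that] by (simp add: vals_def[abs_def])
  have cost: "gblasso_cost E lam M x y f = G (vals f) + lam * (?N f - kink_sum M x (vals f))" for f
    by (simp add: gblasso_cost_def G_def value_cost_def vals_def algebra_simps)
  have cost0: "gblasso_cost E lam M x y f\<^sub>0 = G z\<^sub>0"
  proof -
    have eq: "vals f\<^sub>0 m = z\<^sub>0 m" if "m \<in> {1..M}" for m using f\<^sub>0(2) that by (simp add: vals_def)
    show ?thesis
      using kink_sum_cong[of M "vals f\<^sub>0", OF eq] value_cost_cong[of M "vals f\<^sub>0", OF eq]
      by (simp add: cost f\<^sub>0(3) G_def)
  qed
  have cost_ge: "G (vals f) \<le> gblasso_cost E lam M x y f" if "f \<in> BV2" for f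
    using lower[OF that] lam by (simp add: cost)
  \<comment> \<open>Equality in \<open>G z\<^sub>0 \<le> G (vals f) \<le> cost f\<close> means equality in both steps.\<close>
  have V_iff: "f \<in> ?V \<longleftrightarrow> f \<in> BV2 \<and> (\<forall>m\<in>{1..M}. point_value f (x m) = z\<^sub>0 m) \<and> ?N f = kink_sum M x z\<^sub>0" for f
  proof
    assume "f \<in> ?V"
    then have f: "f \<in> BV2" and min: "gblasso_cost E lam M x y f \<le> G z\<^sub>0"
      using f\<^sub>0(1) cost0 by (auto simp: gblasso_solutions_def is_arg_min_def not_less)
    have "G (vals f) \<le> G z\<^sub>0" using cost_ge[OF f] min by simp
    then have eq: "vals f m = z\<^sub>0 m" if "m \<in> {1..M}" for m
      using z\<^sub>0 that unfolding G_def by (intro value_cost_minimizer_unique[where E = E, OF assms(4) lam])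
    note kink = kink_sum_cong[of M "vals f", OF eq] and val = value_cost_cong[of M "vals f", OF eq]
    have "lam * (?N f - kink_sum M x z\<^sub>0) \<le> 0"
      using min kink val by (simp add: cost G_def)
    then have "?N f \<le> kink_sum M x z\<^sub>0" using lam by (simp add: mult_le_0_iff)
    then show "f \<in> BV2 \<and> (\<forall>m\<in>{1..M}. point_value f (x m) = z\<^sub>0 m) \<and> ?N f = kink_sum M x z\<^sub>0"
      using f eq lower[OF f] kink by (auto simp: vals_def)
  next
    assume f: "f \<in> BV2 \<and> (\<forall>m\<in>{1..M}. point_value f (x m) = z\<^sub>0 m) \<and> ?N f = kink_sum M x z\<^sub>0"
    then have eq: "vals f m = z\<^sub>0 m" if "m \<in> {1..M}" for m using that by (simp add: vals_def)
    have "gblasso_cost E lam M x y f = G z\<^sub>0"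
      using f kink_sum_cong[of M "vals f", OF eq] value_cost_cong[of M "vals f", OF eq]
      by (simp add: cost G_def)
    then show "f \<in> ?V"
      using f order_trans[OF z\<^sub>0 cost_ge] by (auto simp: gblasso_solutions_def is_arg_min_def not_less)
  qed
  have f\<^sub>0V: "f\<^sub>0 \<in> ?V" using f\<^sub>0 by (simp add: V_iff)
  have zz: "z m = z\<^sub>0 m" if "\<forall>f\<in>?V. \<forall>m\<in>{1..M}. point_value f (x m) = z m" "m \<in> {1..M}" for z m
  proof -
    have "point_value f\<^sub>0 (x m) = z m" using that f\<^sub>0V by blast
    then show ?thesis using f\<^sub>0(2)[OF that(2)] by simp
  qed
  show ?thesis
  proof (intro conjI ballI impI)
    show "\<exists>!z. z \<in> extensional {1..M} \<and> (\<forall>f\<in>?V. \<forall>m\<in>{1..M}. point_value f (x m) = z m)"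
    proof (rule ex1I[of _ "restrict z\<^sub>0 {1..M}"])
      show "restrict z\<^sub>0 {1..M} \<in> extensional {1..M} \<and>
          (\<forall>f\<in>?V. \<forall>m\<in>{1..M}. point_value f (x m) = restrict z\<^sub>0 {1..M} m)"
        by (auto simp: V_iff)
      fix z assume "z \<in> extensional {1..M} \<and> (\<forall>f\<in>?V. \<forall>m\<in>{1..M}. point_value f (x m) = z m)"
      then have "z \<in> extensional {1..M}" "\<And>m. m \<in> {1..M} \<Longrightarrow> z m = z\<^sub>0 m"
        by (blast, intro zz) blast+
      then show "z = restrict z\<^sub>0 {1..M}"
        by (intro extensionalityI[of _ "{1..M}"] restrict_extensional) simp_all
    qed
    fix z assume "\<forall>f\<in>?V. \<forall>m\<in>{1..M}. point_value f (x m) = z m"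
    note z = zz[OF this]
    have feasible: "kink_sum M x z\<^sub>0 \<le> ?N f" if "f \<in> BV2" "\<forall>m\<in>{1..M}. point_value f (x m) = z m" for f
    proof -
      note f = that
      have eq: "vals f m = z\<^sub>0 m" if "m \<in> {1..M}" for m
        using that z f(2) by (simp add: vals_def)
      show ?thesis using lower[OF f(1)] kink_sum_cong[of M "vals f", OF eq] by simp
    qed
    have "f \<in> ?V \<longleftrightarrow> is_arg_min ?N (\<lambda>f. f \<in> BV2 \<and> (\<forall>m\<in>{1..M}. point_value f (x m) = z m)) f" for f
    proof
      assume "f \<in> ?V"
      then have f: "f \<in> BV2" "\<forall>m\<in>{1..M}. point_value f (x m) = z m" "?N f = kink_sum M x z\<^sub>0"
        using z by (auto simp: V_iff)
      then show "is_arg_min ?N (\<lambda>f. f \<in> BV2 \<and> (\<forall>m\<in>{1..M}. point_value f (x m) = z m)) f"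
        using leD[OF feasible] unfolding is_arg_min_def f(3) by blast
    next
      assume f: "is_arg_min ?N (\<lambda>f. f \<in> BV2 \<and> (\<forall>m\<in>{1..M}. point_value f (x m) = z m)) f"
      moreover have "\<forall>m\<in>{1..M}. point_value f\<^sub>0 (x m) = z m"
        using f\<^sub>0(2) z by simp
      ultimately have "?N f \<le> ?N f\<^sub>0"
        using f\<^sub>0(1) unfolding is_arg_min_def by (meson not_less)
      then show "f \<in> ?V"
      proof -
        have "f \<in> BV2" "\<forall>m\<in>{1..M}. point_value f (x m) = z m"
          using f by (simp_all add: is_arg_min_def)
        with feasible[OF this] \<open>?N f \<le> ?N f\<^sub>0\<close> show ?thesis
          using z f\<^sub>0(3) by (simp add: V_iff)
      qed
    qed
    then show "?V = {f. is_arg_min ?N (\<lambda>f. f \<in> BV2 \<and> (\<forall>m\<in>{1..M}. point_value f (x m) = z m)) f}"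
      by blast
  qed
qed

end
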